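(* The uniform rotor walk, started at any fixed vertex, is almost surely recurrent on the $F$-lattice and is almost surely recurrent on the Manhattan lattice.
   Context: Both lattices are directed graphs with vertex set $\mathbb{Z}^2$ obtained by orienting each edge of the square grid, and every vertex has indegree 2 and outdegree 2. The $F$-lattice: each vertex $(x,y)$ with $x+y$ even has its two outgoing edges pointing North and South, and each vertex with $x+y$ odd has its two outgoing edges pointing East and West. The Manhattan lattice: all edges in rows $y$ even point East, in rows $y$ odd point West, in columns $x$ even point South, and in columns $x$ odd point North. Rotor walk on such a graph: let $E_v$ be the set of the two outgoing edges of $v$. Initial rotors $\rho(v)\in E_v$ are given. At each time step, the rotor at the current position $X_t$ is switched to the other outgoing edge of $X_t$, and the walker then steps along that edge to $X_{t+1}$; rotors at other vertices are unchanged. The uniform rotor walk has independent initial rotors, $\rho(v)$ uniform on $E_v$. The walk is recurrent if $X_t=X_0$ for infinitely many $t$. *)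

theory Defs
  imports "HOL-Probability.Probability" "Graph_Theory.Digraph"
begin

type_synonym site = "int \<times> int"

definition F_lattice :: "(site, site \<times> site) pre_digraph" where
  "F_lattice = \<lparr>
     verts = UNIV,
     arcs = {((x, y), (x, y + 1)) | x y. even (x + y)}
          \<union> {((x, y), (x, y - 1)) | x y. even (x + y)}
          \<union> {((x, y), (x + 1, y)) | x y. odd (x + y)}
          \<union> {((x, y), (x - 1, y)) | x y. odd (x + y)},
     tail = fst, head = snd\<rparr>"

definition Manhattan_lattice :: "(site, site \<times> site) pre_digraph" where
  "Manhattan_lattice = \<lparr>
     verts = UNIV,
     arcs = {((x, y), (x + 1, y)) | x y. even y}
          \<union> {((x, y), (x - 1, y)) | x y. odd y}
          \<union> {((x, y), (x, y - 1)) | x y. even x}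
          \<union> {((x, y), (x, y + 1)) | x y. odd x},
     tail = fst, head = snd\<rparr>"

(* Meaningful when v has exactly two outgoing arcs, one of which is e. *)
definition other_arc :: "('v, 'e) pre_digraph \<Rightarrow> 'v \<Rightarrow> 'e \<Rightarrow> 'e" where
  "other_arc G v e = (THE e'. e' \<in> out_arcs G v \<and> e' \<noteq> e)"

(* A state consists of the walker's position and the current rotors. The rotor
   is switched first; the walker then follows the new rotor. *)
definition rotor_step :: "('v, 'e) pre_digraph \<Rightarrow> 'v \<times> ('v \<Rightarrow> 'e) \<Rightarrow> 'v \<times> ('v \<Rightarrow> 'e)" where
  "rotor_step G = (\<lambda>(v, \<rho>).
     let e = other_arc G v (\<rho> v) in (head G e, \<rho>(v := e)))"

definition rotor_walk :: "('v, 'e) pre_digraph \<Rightarrow> 'v \<Rightarrow> ('v \<Rightarrow> 'e) \<Rightarrow> nat \<Rightarrow> 'v" where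
  "rotor_walk G v \<rho> t = fst ((rotor_step G ^^ t) (v, \<rho>))"

definition rotor_recurrent :: "('v, 'e) pre_digraph \<Rightarrow> 'v \<Rightarrow> ('v \<Rightarrow> 'e) \<Rightarrow> bool" where
  "rotor_recurrent G v \<rho> \<longleftrightarrow>
     infinite {t. rotor_walk G v \<rho> t = rotor_walk G v \<rho> 0}"

definition uniform_rotors :: "('v, 'e) pre_digraph \<Rightarrow> ('v \<Rightarrow> 'e) measure" where
  "uniform_rotors G = (\<Pi>\<^sub>M v\<in>verts G. uniform_count_measure (out_arcs G v))"

lemma out_arcs_F_lattice:
  "out_arcs F_lattice (x, y) =
     (if even (x + y) then {((x, y), (x, y + 1)), ((x, y), (x, y - 1))}
      else {((x, y), (x + 1, y)), ((x, y), (x - 1, y))})"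
  by (auto simp: out_arcs_def F_lattice_def)

lemma out_arcs_Manhattan_lattice:
  "out_arcs Manhattan_lattice (x, y) =
     {((x, y), (if even y then x + 1 else x - 1, y)),
      ((x, y), (x, if even x then y - 1 else y + 1))}"
  by (auto simp: out_arcs_def Manhattan_lattice_def)

lemma in_arcs_F_lattice:
  "in_arcs F_lattice (x, y) =
     (if even (x + y) then {((x + 1, y), (x, y)), ((x - 1, y), (x, y))}
      else {((x, y + 1), (x, y)), ((x, y - 1), (x, y))})"
  by (auto simp: in_arcs_def F_lattice_def)

lemma in_arcs_Manhattan_lattice:
  "in_arcs Manhattan_lattice (x, y) =
     {((if even y then x - 1 else x + 1, y), (x, y)),
      ((x, if even x then y + 1 else y - 1), (x, y))}"
  by (auto simp: in_arcs_def Manhattan_lattice_def)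

lemma degree_F_lattice:
  "out_degree F_lattice v = 2" "in_degree F_lattice v = 2"
  by (cases v; simp add: out_degree_def in_degree_def out_arcs_F_lattice in_arcs_F_lattice)+

lemma degree_Manhattan_lattice:
  "out_degree Manhattan_lattice v = 2" "in_degree Manhattan_lattice v = 2"
  by (cases v; simp add: out_degree_def in_degree_def
        out_arcs_Manhattan_lattice in_arcs_Manhattan_lattice)+

lemma prob_space_uniform_rotors:
  "prob_space (uniform_rotors F_lattice)" "prob_space (uniform_rotors Manhattan_lattice)"
proof -
  have "finite (out_arcs F_lattice v) \<and> out_arcs F_lattice v \<noteq> {}"
    "finite (out_arcs Manhattan_lattice v) \<and> out_arcs Manhattan_lattice v \<noteq> {}" for v
    by (cases v; simp add: out_arcs_F_lattice out_arcs_Manhattan_lattice)+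
  then show "prob_space (uniform_rotors F_lattice)" "prob_space (uniform_rotors Manhattan_lattice)"
    unfolding uniform_rotors_def
    by (auto intro!: prob_space_PiM prob_space_uniform_count_measure)
qed

lemma other_arc_eq:
  assumes "out_arcs G v = {e, e'}" "e \<noteq> e'"
  shows "other_arc G v e = e'" "other_arc G v e' = e"
  using assms by (auto simp: other_arc_def)

end

(* Until its first return, the rotor walk uses no arc twice: a third passage through a vertex would
   need a third incoming arc. So a vertex is left, on the second passage, along the other outgoing
   arc, as if light were reflected by a two-sided mirror, and the fair independent rotors amount to
   fair independent mirrors. The faces of the grid of one colour form a square lattice with the
   vertices of the grid as bonds; the mirrors declare these bonds open or closed, and the face next
   to the walker moves along open bonds only. A walk that does not return thus follows an infinite
   open path of critical bond percolation, which almost surely does not exist (Harris).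

   The percolation estimate is phrased through the absence of open crossings of rectangles. The
   only planar input is that a left-right and a bottom-top path meet (a parity argument). It gives
   probability at least 1/2 of blocking an n by n + 1 rectangle by self-duality. The argument of
   Bollobas and Riordan (reflect the cluster of the left side of a square) and Harris' inequality
   then block long rectangles, hence annuli, with a probability bounded below at all scales.

   Finally, the rotors at a return are those of the start flipped on a finite set, and such flips
   preserve the uniform measure, so almost surely every return is followed by another one. *)
theory Submission
  imports Defs
begin

text \<open>The obstacle is that a rotor alone is not a mirror: whether it opens its bond depends on
  the face from which the walk first arrives, hence on the rotors met before. This is resolved by
  counting instead of conditioning. Fix the rotors outside a large finite set. The map from the
  remaining rotors to bond configurations is injective, because the walk can be replayed from the
  configuration: when it first reaches a vertex, the entry face is already known, and the state of
  the bond reveals the rotor. Rotors and configurations both number \<open>2 ^ n\<close>, so the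
  rotors that do not return within a time \<open>T\<close> are at most as many as the configurations
  with a long open path. The time \<open>T\<close> can be chosen independently of the rotors, since
  a walk without repeated arcs uses up the finitely many arcs near a bounded region. Percolation is
  therefore needed only on finite sets, where probability is a quotient of cardinalities; measure
  theory enters only through cylinders.\<close>

declare split_paired_All [simp del] split_paired_Ex [simp del]

section \<open>Open paths in the square lattice\<close>

definition adj :: "site \<Rightarrow> site \<Rightarrow> bool" where
  "adj u v \<longleftrightarrow> \<bar>fst u - fst v\<bar> + \<bar>snd u - snd v\<bar> = 1"

text \<open>The bond between adjacent sites \<open>u\<close> and \<open>v\<close> is encoded by \<open>u + v\<close>, i.e. by twice its midpoint.
  The bonds of the dual lattice, encoded in the same way, are the same points shifted by \<open>(1, 1)\<close>.\<close>

definition conn :: "site set \<Rightarrow> site set \<Rightarrow> site \<Rightarrow> site \<Rightarrow> bool" where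
  "conn \<omega> R = (\<lambda>u v. u \<in> R \<and> v \<in> R \<and> adj u v \<and> u + v \<in> \<omega>)\<^sup>*\<^sup>*"

definition joins :: "site set \<Rightarrow> site set \<Rightarrow> site set \<Rightarrow> site set \<Rightarrow> bool" where
  "joins \<omega> R A B \<longleftrightarrow> (\<exists>u\<in>A. \<exists>v\<in>B. conn \<omega> R u v)"

definition bonds :: "site set \<Rightarrow> site set" where
  "bonds R = {u + v | u v. u \<in> R \<and> v \<in> R \<and> adj u v}"

lemma adj_sym: "adj u v \<longleftrightarrow> adj v u"
  by (auto simp: adj_def)

lemma adj_iff: "adj u v \<longleftrightarrow> v \<in> {u + (1, 0), u - (1, 0), u + (0, 1), u - (0, 1)}"
  by (cases u; cases v) (auto simp: adj_def)

lemma conn_refl [simp]: "conn \<omega> R u u"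
  by (simp add: conn_def)

lemma conn_step: "conn \<omega> R u v \<Longrightarrow> v \<in> R \<Longrightarrow> w \<in> R \<Longrightarrow> adj v w \<Longrightarrow> v + w \<in> \<omega> \<Longrightarrow> conn \<omega> R u w"
  unfolding conn_def by (rule rtranclp.rtrancl_into_rtrancl) auto

lemma conn_edge: "v \<in> R \<Longrightarrow> w \<in> R \<Longrightarrow> adj v w \<Longrightarrow> v + w \<in> \<omega> \<Longrightarrow> conn \<omega> R v w"
  by (rule conn_step[OF conn_refl])

lemma conn_trans [trans]: "conn \<omega> R u v \<Longrightarrow> conn \<omega> R v w \<Longrightarrow> conn \<omega> R u w"
  unfolding conn_def by (rule rtranclp_trans)

lemma conn_sym: "conn \<omega> R u v \<Longrightarrow> conn \<omega> R v u"
  unfolding conn_def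
  by (rule sympD[OF symp_rtranclp]) (auto simp: symp_def adj_sym add.commute)

lemma conn_induct [consumes 1, case_names refl step]:
  assumes "conn \<omega> R u v" "P u"
    and "\<And>v w. conn \<omega> R u v \<Longrightarrow> P v \<Longrightarrow> v \<in> R \<Longrightarrow> w \<in> R \<Longrightarrow> adj v w \<Longrightarrow> v + w \<in> \<omega> \<Longrightarrow> P w"
  shows "P v"
  using assms(1) unfolding conn_def
proof (induction rule: rtranclp_induct)
  case base
  show ?case by fact
next
  case (step y z)
  then show ?case using assms(3)[of y z] by (auto simp: conn_def)
qed

text \<open>The inclusion of configurations is required only on \<open>bonds R\<close>. Applied both
  ways, it also shows that connections inside a finite \<open>R\<close> depend on finitely many
  bonds.\<close>

lemma conn_mono:
  assumes "conn \<omega> R u v" "\<omega> \<inter> bonds R \<subseteq> \<omega>'" "R \<subseteq> R'"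
  shows "conn \<omega>' R' u v"
  using assms(1)
proof (induction rule: conn_induct)
  case (step v w)
  then have "v + w \<in> bonds R" unfolding bonds_def by blast
  with step have "v + w \<in> \<omega>'" using assms(2) by blast
  then show ?case using step assms(3) by (blast intro: conn_step)
qed simp

lemma conn_cong: "\<omega> \<inter> bonds R = \<omega>' \<inter> bonds R \<Longrightarrow> conn \<omega> R u v \<longleftrightarrow> conn \<omega>' R u v"
  by (rule iffI; erule conn_mono) auto

text \<open>\<open>conn\<close> is a reflexive closure, so a site outside \<open>R\<close> is still
  connected to itself; that is the only exception.\<close>

lemma conn_in: "conn \<omega> R u v \<Longrightarrow> u \<noteq> v \<Longrightarrow> u \<in> R \<and> v \<in> R"
  by (induction rule: conn_induct) blast+

lemma joins_mono:
  assumes "joins \<omega> R A B" "\<omega> \<inter> bonds R \<subseteq> \<omega>'" "R \<subseteq> R'" "A \<subseteq> A'" "B \<subseteq> B'"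
  shows "joins \<omega>' R' A' B'"
  using assms conn_mono[OF _ assms(2,3)] unfolding joins_def by blast

lemma joins_cong: "\<omega> \<inter> bonds R = \<omega>' \<inter> bonds R \<Longrightarrow> joins \<omega> R A B \<longleftrightarrow> joins \<omega>' R A B"
  unfolding joins_def using conn_cong by metis

lemma bonds_mono: "R \<subseteq> R' \<Longrightarrow> bonds R \<subseteq> bonds R'"
  unfolding bonds_def by blast

lemma finite_bonds: "finite R \<Longrightarrow> finite (bonds R)"
  by (rule finite_subset[of _ "(\<lambda>(u, v). u + v) ` (R \<times> R)"])
    (force simp: bonds_def, intro finite_imageI finite_cartesian_product)

text \<open>Exactly one coordinate of \<open>u + v\<close> is odd, and it reveals the direction of
  the bond; so the doubled midpoint names an undirected bond faithfully.\<close>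

lemma adj_add_eq:
  assumes "adj u v" "adj u' v'" "u + v = u' + v'"
  shows "(u' = u \<and> v' = v) \<or> (u' = v \<and> v' = u)"
proof -
  obtain a b a' b' where "u = (a, b)" "u' = (a', b')"
    by (cases u; cases u')
  with assms show ?thesis unfolding adj_iff
    by (elim insertE emptyE; simp; presburger)
qed

lemma bonds_disjoint:
  assumes "R \<inter> R' = {}" shows "bonds R \<inter> bonds R' = {}"
proof -
  have False if "z \<in> bonds R" "z \<in> bonds R'" for z
  proof -
    obtain u v where "u \<in> R" "v \<in> R" "adj u v" "z = u + v"
      using \<open>z \<in> bonds R\<close> unfolding bonds_def by blast
    moreover obtain u' v' where "u' \<in> R'" "v' \<in> R'" "adj u' v'" "z = u' + v'"
      using \<open>z \<in> bonds R'\<close> unfolding bonds_def by blast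
    ultimately show False using adj_add_eq[of u v u' v'] assms by blast
  qed
  then show ?thesis by blast
qed

subsection \<open>Crossing paths meet\<close>

text \<open>For a path from \<open>a\<close> to \<open>b\<close>, \<open>N u\<close> is the parity of the number of its steps between the columns
  \<open>fst u\<close> and \<open>fst u + 1\<close> above height \<open>snd u\<close>; off the path it changes only at the ends of the path.\<close>

lemma crossing_parity:
  assumes "conn UNIV C a b"
  shows "\<exists>N :: site \<Rightarrow> bool.
    (\<forall>u. u + (0, 1) \<notin> C \<longrightarrow> N (u + (0, 1)) = N u) \<and>
    (\<forall>u. u + (1, 0) \<notin> C \<longrightarrow> (N (u + (1, 0)) = N u) =
       ((fst a = fst u + 1 \<and> snd a > snd u) = (fst b = fst u + 1 \<and> snd b > snd u))) \<and>
    (\<forall>u. (\<forall>z\<in>C. snd z < snd u) \<longrightarrow> \<not> N u) \<and>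
    (\<forall>u. (\<forall>z\<in>C. snd u < snd z) \<longrightarrow> N u = ((fst a \<le> fst u) \<noteq> (fst b \<le> fst u)))"
  using assms
proof (induction rule: conn_induct)
  case refl
  show ?case by (rule exI[of _ "\<lambda>_. False"]) simp
next
  case (step p q)
  then obtain N where N:
    "\<And>u. u + (0, 1) \<notin> C \<Longrightarrow> N (u + (0, 1)) = N u"
    "\<And>u. u + (1, 0) \<notin> C \<Longrightarrow> (N (u + (1, 0)) = N u) =
       ((fst a = fst u + 1 \<and> snd a > snd u) = (fst p = fst u + 1 \<and> snd p > snd u))"
    "\<And>u. (\<forall>z\<in>C. snd z < snd u) \<Longrightarrow> \<not> N u"
    "\<And>u. (\<forall>z\<in>C. snd u < snd z) \<Longrightarrow> N u = ((fst a \<le> fst u) \<noteq> (fst p \<le> fst u))"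
    by blast
  \<comment> \<open>The contribution of the new step to the parity: only a horizontal step counts,
    at the points of its left column below it.\<close>
  define D where "D u \<longleftrightarrow> ((fst p \<le> fst u) \<noteq> (fst q \<le> fst u)) \<and> snd p > snd u" for u
  have D1: "D (u + (0, 1)) = D u" if "u + (0, 1) \<notin> C" for u
  proof -
    have "p \<noteq> u + (0, 1)" "q \<noteq> u + (0, 1)" using that step by auto
    then show ?thesis using \<open>adj p q\<close>
      by (cases u; cases p; cases q) (auto simp: D_def adj_def)
  qed
  \<comment> \<open>A step counts for exactly one of \<open>u\<close> and \<open>u + (1, 0)\<close>
    if exactly one of \<open>p\<close> and \<open>q\<close> lies in the column
    \<open>fst u + 1\<close> above the height of \<open>u\<close>. A vertical step entering that
    part of the column from below would use the avoided site \<open>u + (1, 0)\<close>.\<close>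
  have D2: "(D (u + (1, 0)) = D u) =
     ((fst p = fst u + 1 \<and> snd p > snd u) = (fst q = fst u + 1 \<and> snd q > snd u))"
    if "u + (1, 0) \<notin> C" for u
  proof -
    have "p \<noteq> u + (1, 0)" "q \<noteq> u + (1, 0)" using that step by auto
    with \<open>adj p q\<close> show ?thesis unfolding adj_iff
      by (cases u; cases p) (elim insertE emptyE; simp add: D_def; arith)
  qed
  have D3: "\<not> D u" if "\<forall>z\<in>C. snd z < snd u" for u
    using that \<open>p \<in> C\<close> by (force simp: D_def)
  have D4: "D u = ((fst p \<le> fst u) \<noteq> (fst q \<le> fst u))" if "\<forall>z\<in>C. snd u < snd z" for u
    using that \<open>p \<in> C\<close> by (simp add: D_def)
  show ?case
  proof (rule exI[of _ "\<lambda>u. N u \<noteq> D u"], intro conjI allI impI)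
    show "(N (u + (0, 1)) \<noteq> D (u + (0, 1))) = (N u \<noteq> D u)" if "u + (0, 1) \<notin> C" for u
      using N(1) D1 that by blast
    show "((N (u + (1, 0)) \<noteq> D (u + (1, 0))) = (N u \<noteq> D u)) =
       ((fst a = fst u + 1 \<and> snd a > snd u) = (fst q = fst u + 1 \<and> snd q > snd u))"
      if "u + (1, 0) \<notin> C" for u
      using N(2)[OF that] D2[OF that] by argo
    show "\<not> (N u \<noteq> D u)" if "\<forall>z\<in>C. snd z < snd u" for u
      using N(3)[OF that] D3[OF that] by blast
    show "(N u \<noteq> D u) = ((fst a \<le> fst u) \<noteq> (fst q \<le> fst u))" if "\<forall>z\<in>C. snd u < snd z" for u
      using N(4)[OF that] D4[OF that] by blast
  qed
qed

text \<open>The parity for the first path is odd below the whole path and between the columns of its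
  ends, and even above the path. Along a disjoint second path it cannot change: the strict
  inequalities in \<open>C2\<close> keep the ends of the first path out of all columns concerned.
  \<open>conn UNIV C\<close> serves as a path with sites in \<open>C\<close>, regardless of any bond
  states.\<close>

lemma crossing_paths_meet:
  assumes 1: "conn UNIV C1 a b" "a \<in> C1" and 2: "conn UNIV C2 c d" "c \<in> C2" "d \<in> C2"
    and C2: "\<forall>z\<in>C2. fst a < fst z \<and> fst z < fst b"
    and C1: "\<forall>z\<in>C1. snd c < snd z \<and> snd z < snd d"
  shows "C1 \<inter> C2 \<noteq> {}"
proof
  assume disj: "C1 \<inter> C2 = {}"
  obtain N where N:
    "\<And>u. u + (0, 1) \<notin> C1 \<Longrightarrow> N (u + (0, 1)) = N u"
    "\<And>u. u + (1, 0) \<notin> C1 \<Longrightarrow> (N (u + (1, 0)) = N u) =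
       ((fst a = fst u + 1 \<and> snd a > snd u) = (fst b = fst u + 1 \<and> snd b > snd u))"
    "\<And>u. (\<forall>z\<in>C1. snd z < snd u) \<Longrightarrow> \<not> N u"
    "\<And>u. (\<forall>z\<in>C1. snd u < snd z) \<Longrightarrow> N u = ((fst a \<le> fst u) \<noteq> (fst b \<le> fst u))"
    using crossing_parity[OF 1(1)] by blast
  have up: "N (u + (0, 1)) = N u" if "u + (0, 1) \<in> C2" for u
    using that disj by (intro N(1)) auto
  have right: "N (u + (1, 0)) = N u" if "u + (1, 0) \<in> C2" for u
  proof -
    have "u + (1, 0) \<notin> C1" using that disj by blast
    moreover have "fst a \<noteq> fst u + 1" "fst b \<noteq> fst u + 1" using that C2 by force+
    ultimately show ?thesis using N(2)[of u] by simp
  qed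
  have "N d = N c"
    using 2(1)
  proof (induction rule: conn_induct)
    case (step v w)
    from \<open>adj v w\<close> consider "w = v + (1, 0)" | "v = w + (1, 0)" | "w = v + (0, 1)" | "v = w + (0, 1)"
      unfolding adj_iff by force
    then have "N w = N v" using up right step by cases auto
    then show ?case using step by simp
  qed simp
  moreover have "N c" using N(4)[of c] C1 C2 2(2) by force
  moreover have "\<not> N d" using N(3)[of d] C1 by blast
  ultimately show False by blast
qed

section \<open>Uniform random subsets of a finite set\<close>

definition pr :: "'a set \<Rightarrow> ('a set \<Rightarrow> bool) \<Rightarrow> real" where
  "pr E Q = card {\<omega>. \<omega> \<subseteq> E \<and> Q \<omega>} / 2 ^ card E"

definition determined :: "'a set \<Rightarrow> ('a set \<Rightarrow> bool) \<Rightarrow> bool" where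
  "determined E Q \<longleftrightarrow> (\<forall>\<omega>. Q (\<omega> \<inter> E) = Q \<omega>)"

text \<open>Decreasing rather than increasing, because the events to be combined express that open
  paths are absent.\<close>

definition decreasing :: "('a set \<Rightarrow> bool) \<Rightarrow> bool" where
  "decreasing Q \<longleftrightarrow> (\<forall>\<alpha> \<beta>. \<alpha> \<subseteq> \<beta> \<longrightarrow> Q \<beta> \<longrightarrow> Q \<alpha>)"

lemma pr_nonneg: "0 \<le> pr E Q"
  by (simp add: pr_def)

lemma pr_cong: "(\<And>\<omega>. \<omega> \<subseteq> E \<Longrightarrow> P \<omega> = Q \<omega>) \<Longrightarrow> pr E P = pr E Q"
proof -
  assume "\<And>\<omega>. \<omega> \<subseteq> E \<Longrightarrow> P \<omega> = Q \<omega>"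
  then have "{\<omega>. \<omega> \<subseteq> E \<and> P \<omega>} = {\<omega>. \<omega> \<subseteq> E \<and> Q \<omega>}" by blast
  then show ?thesis by (simp add: pr_def)
qed

lemma finite_configurations: "finite E \<Longrightarrow> finite {\<omega>. \<omega> \<subseteq> E \<and> Q \<omega>}"
  by (rule finite_subset[of _ "Pow E"]) auto

lemma pr_mono:
  assumes "finite E" "\<And>\<omega>. \<omega> \<subseteq> E \<Longrightarrow> P \<omega> \<Longrightarrow> Q \<omega>"
  shows "pr E P \<le> pr E Q"
proof -
  have "card {\<omega>. \<omega> \<subseteq> E \<and> P \<omega>} \<le> card {\<omega>. \<omega> \<subseteq> E \<and> Q \<omega>}"
    using assms(2) by (intro card_mono finite_configurations assms(1)) blast
  then show ?thesis by (simp add: pr_def divide_right_mono)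
qed

lemma pr_True: "finite E \<Longrightarrow> pr E (\<lambda>_. True) = 1"
  by (simp add: pr_def card_Pow flip: Pow_def)

lemma pr_split:
  assumes "finite E"
  shows "pr E Q = pr E (\<lambda>\<omega>. P \<omega> \<and> Q \<omega>) + pr E (\<lambda>\<omega>. \<not> P \<omega> \<and> Q \<omega>)"
proof -
  have "card {\<omega>. \<omega> \<subseteq> E \<and> Q \<omega>} =
      card ({\<omega>. \<omega> \<subseteq> E \<and> P \<omega> \<and> Q \<omega>} \<union> {\<omega>. \<omega> \<subseteq> E \<and> \<not> P \<omega> \<and> Q \<omega>})"
    by (rule arg_cong[of _ _ card]) auto
  also have "\<dots> = card {\<omega>. \<omega> \<subseteq> E \<and> P \<omega> \<and> Q \<omega>} + card {\<omega>. \<omega> \<subseteq> E \<and> \<not> P \<omega> \<and> Q \<omega>}"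
    using assms by (intro card_Un_disjoint finite_configurations) auto
  finally show ?thesis by (simp add: pr_def add_divide_distrib)
qed

lemma pr_not: "finite E \<Longrightarrow> pr E (\<lambda>\<omega>. \<not> P \<omega>) = 1 - pr E P"
  using pr_split[of E "\<lambda>_. True" P] pr_True[of E] by simp

lemma pr_disj_le:
  assumes "finite E"
  shows "pr E (\<lambda>\<omega>. P \<omega> \<or> Q \<omega>) \<le> pr E P + pr E Q"
proof -
  have "pr E (\<lambda>\<omega>. P \<omega> \<or> Q \<omega>) = pr E (\<lambda>\<omega>. P \<omega> \<and> (P \<omega> \<or> Q \<omega>)) + pr E (\<lambda>\<omega>. \<not> P \<omega> \<and> (P \<omega> \<or> Q \<omega>))"
    by (rule pr_split) fact
  also have "\<dots> \<le> pr E P + pr E Q"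
    by (intro add_mono pr_mono assms) auto
  finally show ?thesis .
qed

lemma pr_sum:
  assumes "finite E" "finite I"
  shows "pr E (\<lambda>\<omega>. f \<omega> \<in> I \<and> Q \<omega>) = (\<Sum>i\<in>I. pr E (\<lambda>\<omega>. f \<omega> = i \<and> Q \<omega>))"
  using assms(2)
proof induction
  case empty
  then show ?case by (simp add: pr_def)
next
  case (insert i I)
  have "pr E (\<lambda>\<omega>. f \<omega> \<in> insert i I \<and> Q \<omega>) =
      pr E (\<lambda>\<omega>. f \<omega> = i \<and> f \<omega> \<in> insert i I \<and> Q \<omega>) + pr E (\<lambda>\<omega>. \<not> f \<omega> = i \<and> f \<omega> \<in> insert i I \<and> Q \<omega>)"
    by (rule pr_split) fact
  also have "pr E (\<lambda>\<omega>. f \<omega> = i \<and> f \<omega> \<in> insert i I \<and> Q \<omega>) = pr E (\<lambda>\<omega>. f \<omega> = i \<and> Q \<omega>)"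
    by (rule pr_cong) auto
  also have "pr E (\<lambda>\<omega>. \<not> f \<omega> = i \<and> f \<omega> \<in> insert i I \<and> Q \<omega>) = pr E (\<lambda>\<omega>. f \<omega> \<in> I \<and> Q \<omega>)"
    using insert by (intro pr_cong) auto
  finally show ?case using insert by simp
qed

lemma pr_Un:
  assumes "finite E" "finite F" "E \<inter> F = {}"
  shows "pr (E \<union> F) (\<lambda>\<omega>. P (\<omega> \<inter> E) \<and> Q (\<omega> \<inter> F)) = pr E P * pr F Q"
proof -
  have "bij_betw (\<lambda>(\<alpha>, \<beta>). \<alpha> \<union> \<beta>) ({\<omega>. \<omega> \<subseteq> E \<and> P \<omega>} \<times> {\<omega>. \<omega> \<subseteq> F \<and> Q \<omega>})
      {\<omega>. \<omega> \<subseteq> E \<union> F \<and> P (\<omega> \<inter> E) \<and> Q (\<omega> \<inter> F)}"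
  proof (rule bij_betw_byWitness[where f' = "\<lambda>\<omega>. (\<omega> \<inter> E, \<omega> \<inter> F)"])
    have 1: "(\<alpha> \<union> \<beta>) \<inter> E = \<alpha>" "(\<alpha> \<union> \<beta>) \<inter> F = \<beta>" if "\<alpha> \<subseteq> E" "\<beta> \<subseteq> F" for \<alpha> \<beta>
      using that assms(3) by auto
    show "\<forall>a\<in>{\<omega>. \<omega> \<subseteq> E \<and> P \<omega>} \<times> {\<omega>. \<omega> \<subseteq> F \<and> Q \<omega>}.
        (\<lambda>\<omega>. (\<omega> \<inter> E, \<omega> \<inter> F)) (case a of (\<alpha>, \<beta>) \<Rightarrow> \<alpha> \<union> \<beta>) = a"
      using 1 by auto
    show "(\<lambda>(\<alpha>, \<beta>). \<alpha> \<union> \<beta>) ` ({\<omega>. \<omega> \<subseteq> E \<and> P \<omega>} \<times> {\<omega>. \<omega> \<subseteq> F \<and> Q \<omega>})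
        \<subseteq> {\<omega>. \<omega> \<subseteq> E \<union> F \<and> P (\<omega> \<inter> E) \<and> Q (\<omega> \<inter> F)}"
      using 1 by (auto simp: Int_commute)
  qed auto
  then have "card {\<omega>. \<omega> \<subseteq> E \<union> F \<and> P (\<omega> \<inter> E) \<and> Q (\<omega> \<inter> F)} =
      card {\<omega>. \<omega> \<subseteq> E \<and> P \<omega>} * card {\<omega>. \<omega> \<subseteq> F \<and> Q \<omega>}"
    by (simp add: bij_betw_same_card[symmetric] card_cartesian_product)
  then show ?thesis
    using assms by (simp add: pr_def card_Un_disjoint power_add)
qed

lemma pr_superset:
  assumes "finite E" "F \<subseteq> E" "determined F Q"
  shows "pr E Q = pr F Q"
proof -
  have fin: "finite F" "finite (E - F)" using assms finite_subset by auto
  have "pr E Q = pr (F \<union> (E - F)) (\<lambda>\<omega>. Q (\<omega> \<inter> F) \<and> True)"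
    using assms by (auto simp: determined_def Un_absorb1)
  also have "\<dots> = pr F Q"
    using pr_Un[of F "E - F" Q "\<lambda>_. True"] fin by (simp add: pr_True Diff_disjoint)
  finally show ?thesis .
qed

lemma determined_mono: "determined F Q \<Longrightarrow> F \<subseteq> E \<Longrightarrow> determined E Q"
  unfolding determined_def by (metis Int_assoc Int_absorb1)

lemma determined_conj: "determined E P \<Longrightarrow> determined E Q \<Longrightarrow> determined E (\<lambda>\<omega>. P \<omega> \<and> Q \<omega>)"
  by (simp add: determined_def)

lemma determined_not: "determined E P \<Longrightarrow> determined E (\<lambda>\<omega>. \<not> P \<omega>)"
  by (simp add: determined_def)

lemma pr_indep:
  assumes "finite E" "F \<subseteq> E" "H \<subseteq> E" "F \<inter> H = {}" "determined F P" "determined H Q"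
  shows "pr E (\<lambda>\<omega>. P \<omega> \<and> Q \<omega>) = pr E P * pr E Q"
proof -
  have fin: "finite F" "finite H" using assms by (auto intro: finite_subset)
  have "determined (F \<union> H) (\<lambda>\<omega>. P \<omega> \<and> Q \<omega>)"
    using assms by (intro determined_conj determined_mono[OF assms(5)] determined_mono[OF assms(6)]) auto
  then have "pr E (\<lambda>\<omega>. P \<omega> \<and> Q \<omega>) = pr (F \<union> H) (\<lambda>\<omega>. P \<omega> \<and> Q \<omega>)"
    using assms by (intro pr_superset) auto
  also have "\<dots> = pr (F \<union> H) (\<lambda>\<omega>. P (\<omega> \<inter> F) \<and> Q (\<omega> \<inter> H))"
    using assms by (simp add: determined_def)
  also have "\<dots> = pr F P * pr H Q"
    using fin assms by (intro pr_Un)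
  also have "\<dots> = pr E P * pr E Q"
    using assms by (simp add: pr_superset[of E F] pr_superset[of E H])
  finally show ?thesis .
qed

lemma pr_image:
  assumes "inj_on \<tau> E"
  shows "pr (\<tau> ` E) Q = pr E (\<lambda>\<omega>. Q (\<tau> ` \<omega>))"
proof -
  have "bij_betw ((`) \<tau>) {\<omega>. \<omega> \<subseteq> E \<and> Q (\<tau> ` \<omega>)} {\<omega>. \<omega> \<subseteq> \<tau> ` E \<and> Q \<omega>}"
    unfolding bij_betw_def
  proof
    show "inj_on ((`) \<tau>) {\<omega>. \<omega> \<subseteq> E \<and> Q (\<tau> ` \<omega>)}"
      by (rule inj_on_subset[OF inj_on_image_Pow[OF assms]]) auto
    show "(`) \<tau> ` {\<omega>. \<omega> \<subseteq> E \<and> Q (\<tau> ` \<omega>)} = {\<omega>. \<omega> \<subseteq> \<tau> ` E \<and> Q \<omega>}"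
      by (auto simp: subset_image_iff image_iff)
  qed
  then show ?thesis
    by (simp add: pr_def bij_betw_same_card card_image[OF assms])
qed

text \<open>Open and closed bonds are equally likely; self-duality uses the parameter 1/2 through
  this symmetry.\<close>

lemma pr_Compl: "pr E (\<lambda>\<omega>. Q (E - \<omega>)) = pr E Q"
proof -
  have "bij_betw (\<lambda>\<omega>. E - \<omega>) {\<omega>. \<omega> \<subseteq> E \<and> Q (E - \<omega>)} {\<omega>. \<omega> \<subseteq> E \<and> Q \<omega>}"
    by (rule bij_betw_byWitness[where f' = "\<lambda>\<omega>. E - \<omega>"]) (auto simp: double_diff)
  then show ?thesis by (simp add: pr_def bij_betw_same_card)
qed

section \<open>Harris' inequality, by conditioning on one bond at a time\<close>

lemma pr_insert:
  assumes "finite E" "x \<notin> E"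
  shows "pr (insert x E) Q = (pr E Q + pr E (\<lambda>\<omega>. Q (insert x \<omega>))) / 2"
proof -
  have "{\<omega>. \<omega> \<subseteq> insert x E \<and> Q \<omega>} =
      {\<omega>. \<omega> \<subseteq> E \<and> Q \<omega>} \<union> insert x ` {\<omega>. \<omega> \<subseteq> E \<and> Q (insert x \<omega>)}" (is "_ = ?A \<union> insert x ` ?B")
  proof -
    have "\<omega> \<in> insert x ` ?B" if "\<omega> \<subseteq> insert x E" "Q \<omega>" "x \<in> \<omega>" for \<omega>
      using that by (intro image_eqI[of _ _ "\<omega> - {x}"]) (auto simp: insert_absorb)
    then show ?thesis by auto
  qed
  moreover have "card (?A \<union> insert x ` ?B) = card ?A + card (insert x ` ?B)"
    using assms by (intro card_Un_disjoint) auto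
  moreover have "card (insert x ` ?B) = card ?B"
    by (rule card_image, rule inj_onI) (use assms in \<open>auto simp: insert_ident subset_iff\<close>)
  ultimately show ?thesis
    using assms by (simp add: pr_def add_divide_distrib)
qed

lemma decreasing_insert:
  assumes "decreasing P" shows "decreasing (\<lambda>\<omega>. P (insert x \<omega>))"
  unfolding decreasing_def
proof (intro allI impI)
  fix \<alpha> \<beta> assume "\<alpha> \<subseteq> \<beta>" "P (insert x \<beta>)"
  moreover have "insert x \<alpha> \<subseteq> insert x \<beta>" using \<open>\<alpha> \<subseteq> \<beta>\<close> by blast
  ultimately show "P (insert x \<alpha>)" using assms unfolding decreasing_def by blast
qed

text \<open>Induction on the number of bonds. Conditioned on the state of \<open>x\<close>, the
  hypothesis gives products, and what remains is Chebyshev's sum inequality for two values.\<close>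

lemma harris_inequality:
  assumes "finite E" "decreasing P" "decreasing Q"
  shows "pr E P * pr E Q \<le> pr E (\<lambda>\<omega>. P \<omega> \<and> Q \<omega>)"
  using assms
proof (induction arbitrary: P Q)
  case empty
  have "{\<omega>. \<omega> = {} \<and> R \<omega>} = (if R {} then {{}} else {})" for R :: "'a set \<Rightarrow> bool"
    by auto
  then show ?case by (simp add: pr_def)
next
  case (insert x E)
  let ?P = "\<lambda>\<omega>. P (insert x \<omega>)" and ?Q = "\<lambda>\<omega>. Q (insert x \<omega>)"
  define a b a' b' where "a = pr E P" "b = pr E Q" "a' = pr E ?P" "b' = pr E ?Q"
  have anti: "decreasing ?P" "decreasing ?Q"
    using insert.prems by (auto intro: decreasing_insert)
  have le: "a' \<le> a" "b' \<le> b"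
    using insert.prems insert.hyps(1) unfolding a_b_a'_b'_def decreasing_def
    by (meson pr_mono subset_insertI)+
  \<comment> \<open>Opening \<open>x\<close> can only destroy a decreasing event, so both
    differences are nonnegative.\<close>
  have "0 \<le> (a - a') * (b - b')"
    using le by simp
  then have "(a + a') / 2 * ((b + b') / 2) \<le> (a * b + a' * b') / 2"
    by (simp add: field_simps)
  also have "\<dots> \<le> (pr E (\<lambda>\<omega>. P \<omega> \<and> Q \<omega>) + pr E (\<lambda>\<omega>. ?P \<omega> \<and> ?Q \<omega>)) / 2"
    unfolding a_b_a'_b'_def
    using insert.IH[OF insert.prems] insert.IH[OF anti] by (intro divide_right_mono add_mono) auto
  finally show ?case
    using insert.hyps by (simp add: pr_insert a_b_a'_b'_def)
qed

section \<open>Symmetries of the lattice\<close>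

text \<open>\<open>\<tau>\<close> is the action of the symmetry \<open>\<sigma>\<close> on bonds,
  that is, on doubled midpoints; hence the doubled constants in the instances below.\<close>

definition isom :: "(site \<Rightarrow> site) \<Rightarrow> (site \<Rightarrow> site) \<Rightarrow> bool" where
  "isom \<sigma> \<tau> \<longleftrightarrow> bij \<sigma> \<and> inj \<tau> \<and>
     (\<forall>u v. adj (\<sigma> u) (\<sigma> v) = adj u v) \<and> (\<forall>u v. adj u v \<longrightarrow> \<sigma> u + \<sigma> v = \<tau> (u + v))"

lemma isom_adj: "isom \<sigma> \<tau> \<Longrightarrow> adj (\<sigma> u) (\<sigma> v) \<longleftrightarrow> adj u v"
  and isom_add: "isom \<sigma> \<tau> \<Longrightarrow> adj u v \<Longrightarrow> \<sigma> u + \<sigma> v = \<tau> (u + v)"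
  by (auto simp: isom_def)

lemma conn_isom:
  assumes "isom \<sigma> \<tau>"
  shows "conn (\<tau> ` \<omega>) (\<sigma> ` R) (\<sigma> u) (\<sigma> v) \<longleftrightarrow> conn \<omega> R u v"
proof
  have inj: "inj \<sigma>" "inj \<tau>" using assms by (auto simp: isom_def bij_def)
  have "\<exists>y'. y = \<sigma> y' \<and> conn \<omega> R u y'" if "conn (\<tau> ` \<omega>) (\<sigma> ` R) (\<sigma> u) y" for y
    using that
  proof (induction rule: conn_induct)
    case (step y z)
    then obtain y' z' where *: "y = \<sigma> y'" "z = \<sigma> z'" "conn \<omega> R u y'" "z' \<in> R"
      by blast
    then have "y' \<in> R" "adj y' z'"
      using step inj by (auto simp: isom_adj[OF assms] inj_image_mem_iff)
    then have "\<tau> (y' + z') \<in> \<tau> ` \<omega>"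
      using step * isom_add[OF assms] by metis
    then have "y' + z' \<in> \<omega>" using inj by (simp add: inj_image_mem_iff)
    then show ?case
      using * \<open>y' \<in> R\<close> \<open>adj y' z'\<close> conn_step by blast
  qed auto
  then show "conn (\<tau> ` \<omega>) (\<sigma> ` R) (\<sigma> u) (\<sigma> v) \<Longrightarrow> conn \<omega> R u v"
    using inj(1) by (metis injD)
  show "conn \<omega> R u v \<Longrightarrow> conn (\<tau> ` \<omega>) (\<sigma> ` R) (\<sigma> u) (\<sigma> v)"
  proof (induction rule: conn_induct)
    case (step y z)
    then have "adj (\<sigma> y) (\<sigma> z)" "\<sigma> y + \<sigma> z \<in> \<tau> ` \<omega>"
      by (simp_all add: isom_adj[OF assms] isom_add[OF assms])
    then show ?case using step by (auto intro: conn_step)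
  qed simp
qed

lemma joins_isom:
  "isom \<sigma> \<tau> \<Longrightarrow> joins (\<tau> ` \<omega>) (\<sigma> ` R) (\<sigma> ` A) (\<sigma> ` B) \<longleftrightarrow> joins \<omega> R A B"
  by (simp add: joins_def conn_isom)

lemma bonds_isom:
  assumes "isom \<sigma> \<tau>"
  shows "bonds (\<sigma> ` R) = \<tau> ` bonds R"
proof
  show "bonds (\<sigma> ` R) \<subseteq> \<tau> ` bonds R"
  proof
    fix z assume "z \<in> bonds (\<sigma> ` R)"
    then obtain u v where uv: "u \<in> R" "v \<in> R" "adj (\<sigma> u) (\<sigma> v)" "z = \<sigma> u + \<sigma> v"
      unfolding bonds_def by blast
    then have "adj u v" "z = \<tau> (u + v)"
      using isom_adj[OF assms] isom_add[OF assms] by auto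
    then show "z \<in> \<tau> ` bonds R"
      using uv unfolding bonds_def by blast
  qed
  show "\<tau> ` bonds R \<subseteq> bonds (\<sigma> ` R)"
  proof
    fix z assume "z \<in> \<tau> ` bonds R"
    then obtain u v where uv: "u \<in> R" "v \<in> R" "adj u v" "z = \<tau> (u + v)"
      unfolding bonds_def by blast
    then have "adj (\<sigma> u) (\<sigma> v)" "z = \<sigma> u + \<sigma> v"
      using isom_adj[OF assms] isom_add[OF assms] by auto
    then show "z \<in> bonds (\<sigma> ` R)"
      using uv unfolding bonds_def by blast
  qed
qed

definition join_prob :: "site set \<Rightarrow> site set \<Rightarrow> site set \<Rightarrow> real" where
  "join_prob R A B = pr (bonds R) (\<lambda>\<omega>. joins \<omega> R A B)"

lemma determined_joins: "bonds R \<subseteq> E \<Longrightarrow> determined E (\<lambda>\<omega>. joins \<omega> R A B)"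
  unfolding determined_def by (intro allI joins_cong) auto

lemma decreasing_not_joins: "decreasing (\<lambda>\<omega>. \<not> joins \<omega> R A B)"
  unfolding decreasing_def using joins_mono by blast

lemma pr_joins:
  "finite E \<Longrightarrow> bonds R \<subseteq> E \<Longrightarrow> pr E (\<lambda>\<omega>. joins \<omega> R A B) = join_prob R A B"
  unfolding join_prob_def by (intro pr_superset determined_joins) auto

lemma join_prob_isom:
  assumes "isom \<sigma> \<tau>"
  shows "join_prob (\<sigma> ` R) (\<sigma> ` A) (\<sigma> ` B) = join_prob R A B"
proof -
  have "inj_on \<tau> (bonds R)"
    using assms by (auto simp: isom_def intro: inj_on_subset)
  then show ?thesis
    by (simp add: join_prob_def bonds_isom[OF assms] pr_image joins_isom[OF assms])
qed

lemma isom_translate: "isom (\<lambda>u. u + c) (\<lambda>z. z + (c + c))"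
  unfolding isom_def by (auto simp: adj_def algebra_simps bij_plus_right)

lemma isom_swap: "isom prod.swap prod.swap"
  by (auto simp: isom_def adj_def)

lemma isom_flip_fst: "isom (\<lambda>(x, y). (a - x, y)) (\<lambda>(x, y). (2 * a - x, y))"
proof -
  have "bij (\<lambda>(x, y). (a - x, y :: int))"
    by (rule bij_betw_byWitness[where f' = "\<lambda>(x, y). (a - x, y)"]) auto
  then show ?thesis by (auto simp: isom_def adj_def inj_def)
qed

lemma isom_flip_snd: "isom (\<lambda>(x, y). (x, a - y)) (\<lambda>(x, y). (x, 2 * a - y))"
proof -
  have "bij (\<lambda>(x :: int, y). (x, a - y))"
    by (rule bij_betw_byWitness[where f' = "\<lambda>(x, y). (x, a - y)"]) auto
  then show ?thesis by (auto simp: isom_def adj_def inj_def)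
qed

section \<open>Crossings of rectangles\<close>

definition rect :: "int \<Rightarrow> int \<Rightarrow> int \<Rightarrow> int \<Rightarrow> site set" where
  "rect a b c d = {a..b} \<times> {c..d}"

definition vcross :: "site set \<Rightarrow> int \<Rightarrow> int \<Rightarrow> int \<Rightarrow> int \<Rightarrow> bool" where
  "vcross \<omega> a b c d \<longleftrightarrow> joins \<omega> (rect a b c d) ({a..b} \<times> {c}) ({a..b} \<times> {d})"

definition hcross :: "site set \<Rightarrow> int \<Rightarrow> int \<Rightarrow> int \<Rightarrow> int \<Rightarrow> bool" where
  "hcross \<omega> a b c d \<longleftrightarrow> joins \<omega> (rect a b c d) ({a} \<times> {c..d}) ({b} \<times> {c..d})"

text \<open>Width and height count sites, not edges. With this convention the self-dual shape is
  \<open>n\<close> by \<open>n + 1\<close>.\<close>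

definition vprob :: "int \<Rightarrow> int \<Rightarrow> real" where
  "vprob w h = join_prob (rect 1 w 1 h) ({1..w} \<times> {1}) ({1..w} \<times> {h})"

lemma finite_rect [simp]: "finite (rect a b c d)"
  by (simp add: rect_def)

lemma mem_rect [simp]: "(x, y) \<in> rect a b c d \<longleftrightarrow> a \<le> x \<and> x \<le> b \<and> c \<le> y \<and> y \<le> d"
  by (auto simp: rect_def)

lemma translate_Times: "(\<lambda>u. u + c) ` (A \<times> B) = (\<lambda>x. x + fst c) ` A \<times> (\<lambda>x. x + snd c) ` B"
  for c :: site
  by (cases c) (auto simp: image_iff)

lemma join_prob_vcross:
  "join_prob (rect a b c d) ({a..b} \<times> {c}) ({a..b} \<times> {d}) = vprob (b - a + 1) (d - c + 1)"
  using join_prob_isom[OF isom_translate[of "(a - 1, c - 1)"], of "rect 1 (b - a + 1) 1 (d - c + 1)"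
      "{1..b - a + 1} \<times> {1}" "{1..b - a + 1} \<times> {d - c + 1}"]
  by (simp add: translate_Times rect_def vprob_def)

lemma pr_vcross:
  "finite E \<Longrightarrow> bonds (rect a b c d) \<subseteq> E \<Longrightarrow>
     pr E (\<lambda>\<omega>. vcross \<omega> a b c d) = vprob (b - a + 1) (d - c + 1)"
  by (simp add: vcross_def pr_joins join_prob_vcross)

lemma pr_hcross:
  assumes "finite E" "bonds (rect a b c d) \<subseteq> E"
  shows "pr E (\<lambda>\<omega>. hcross \<omega> a b c d) = vprob (d - c + 1) (b - a + 1)"
proof -
  have "pr E (\<lambda>\<omega>. hcross \<omega> a b c d) = join_prob (rect a b c d) ({a} \<times> {c..d}) ({b} \<times> {c..d})"
    using assms by (simp add: hcross_def pr_joins)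
  also have "\<dots> = join_prob (rect c d a b) ({c..d} \<times> {a}) ({c..d} \<times> {b})"
    using join_prob_isom[OF isom_swap, of "rect c d a b" "{c..d} \<times> {a}" "{c..d} \<times> {b}"]
    by (simp add: rect_def product_swap)
  finally show ?thesis by (simp add: join_prob_vcross)
qed

lemma vprob_mono:
  assumes "w \<le> w'"
  shows "vprob w h \<le> vprob w' h"
proof -
  have sub: "bonds (rect 1 w 1 h) \<subseteq> bonds (rect 1 w' 1 h)"
    using assms by (intro bonds_mono) (auto simp: rect_def)
  have "pr (bonds (rect 1 w' 1 h)) (\<lambda>\<omega>. vcross \<omega> 1 w 1 h)
      \<le> pr (bonds (rect 1 w' 1 h)) (\<lambda>\<omega>. vcross \<omega> 1 w' 1 h)"
    unfolding vcross_def using assms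
    by (intro pr_mono) (auto intro!: finite_bonds elim!: joins_mono simp: rect_def)
  then show ?thesis
    using sub by (simp add: pr_vcross finite_bonds)
qed

lemma vprob_le_1: "vprob w h \<le> 1"
  using pr_mono[of "bonds (rect 1 w 1 h)" _ "\<lambda>_. True"]
  by (simp add: vprob_def join_prob_def pr_True finite_bonds)

subsection \<open>Self-duality\<close>

text \<open>The dual site named \<open>v\<close> sits at \<open>v\<close> plus half a unit in both
  directions, so the dual bond with code \<open>z\<close> crosses the bond with code
  \<open>z + (1, 1)\<close> and is open when the latter is closed.\<close>

definition dual :: "site set \<Rightarrow> site set" where
  "dual \<omega> = {z. z + (1, 1) \<notin> \<omega>}"

text \<open>In doubled coordinates a dual path runs through odd points and midpoints of closed
  bonds, a primal path through even points and midpoints of open bonds. These sets are disjoint,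
  whereas the two paths would have to meet.\<close>

lemma not_vcross_and_dual_hcross:
  assumes "vcross \<omega> 1 n 1 (n + 1)" "hcross (dual \<omega>) 0 n 1 n"
  shows False
proof -
  \<comment> \<open>The bounds are the doubled ranges of the two rectangles: the dual path runs from
    column 1 to column \<open>2 * n + 1\<close>, the primal one from row 2 to row
    \<open>2 * n + 2\<close>, so each sticks out by one on both sides.\<close>
  define C1 where "C1 = {z. (odd (fst z) \<and> odd (snd z) \<or> odd (fst z + snd z) \<and> z \<notin> \<omega>) \<and>
    3 \<le> snd z \<and> snd z \<le> 2 * n + 1}"
  define C2 where "C2 = {z. (even (fst z) \<and> even (snd z) \<or> odd (fst z + snd z) \<and> z \<in> \<omega>) \<and>
    2 \<le> fst z \<and> fst z \<le> 2 * n}"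
  obtain u v where uv: "u \<in> {1..n} \<times> {1}" "v \<in> {1..n} \<times> {n + 1}" "conn \<omega> (rect 1 n 1 (n + 1)) u v"
    using assms(1) by (auto simp: vcross_def joins_def)
  obtain p q where pq: "p \<in> {0} \<times> {1..n}" "q \<in> {n} \<times> {1..n}" "conn (dual \<omega>) (rect 0 n 1 n) p q"
    using assms(2) by (auto simp: hcross_def joins_def)
  have 1: "conn UNIV C1 (p + p + (1, 1)) (q + q + (1, 1))"
    using pq(3)
  proof (induction rule: conn_induct)
    case (step v w)
    let ?f = "\<lambda>v. v + v + (1, 1) :: site"
    have m: "v + w + (1, 1) \<in> C1" "?f v \<in> C1" "?f w \<in> C1"
      "adj (?f v) (v + w + (1, 1))" "adj (v + w + (1, 1)) (?f w)"
      using step.hyps unfolding adj_iff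
      by (cases v; elim insertE emptyE; force simp: C1_def dual_def)+
    then have "conn UNIV C1 (?f v) (?f w)"
      by (meson UNIV_I conn_edge conn_trans)
    then show ?case using step.IH conn_trans by blast
  qed simp
  have 2: "conn UNIV C2 (u + u) (v + v)"
    using uv(3)
  proof (induction rule: conn_induct)
    case (step v w)
    have m: "v + w \<in> C2" "v + v \<in> C2" "w + w \<in> C2" "adj (v + v) (v + w)" "adj (v + w) (w + w)"
      using step.hyps unfolding adj_iff
      by (cases v; elim insertE emptyE; force simp: C2_def)+
    then have "conn UNIV C2 (v + v) (w + w)"
      by (meson UNIV_I conn_edge conn_trans)
    then show ?case using step.IH conn_trans by blast
  qed simp
  have "C1 \<inter> C2 \<noteq> {}"
    by (rule crossing_paths_meet[OF 1 _ 2]) (use uv(1,2) pq(1,2) in \<open>auto simp: C1_def C2_def\<close>)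
  then show False by (auto simp: C1_def C2_def)
qed

text \<open>The dual rectangle has \<open>n + 1\<close> by \<open>n\<close> sites, so its horizontal
  crossing is as likely as the vertical crossing of the original one after a quarter turn. The two
  events exclude each other, hence twice the probability is at most 1.\<close>

lemma vprob_self_dual: "vprob n (n + 1) \<le> 1 / 2"
proof -
  let ?R = "bonds (rect 1 n 1 (n + 1))" and ?R' = "bonds (rect 0 n 1 n)"
  let ?s = "\<lambda>z. z + (1, 1) :: site" and ?t = "\<lambda>z. z - (1, 1) :: site"
  \<comment> \<open>Both the bonds of the rectangle and the bonds crossed by the dual rectangle, so
    that the two events live on one finite space.\<close>
  define E where "E = ?R \<union> ?s ` ?R'"
  have fin: "finite E" by (auto simp: E_def finite_bonds)
  have "pr E (\<lambda>\<omega>. hcross (dual \<omega>) 0 n 1 n) = pr E (\<lambda>\<omega>. hcross (?t ` (E - \<omega>)) 0 n 1 n)"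
  proof (rule pr_cong)
    fix \<omega> assume "\<omega> \<subseteq> E"
    have "z \<in> dual \<omega> \<longleftrightarrow> z \<in> ?t ` (E - \<omega>)" if "z \<in> ?R'" for z
    proof -
      have "z \<in> ?t ` (E - \<omega>) \<longleftrightarrow> ?s z \<in> E - \<omega>"
        by (metis (no_types, lifting) add_diff_cancel diff_add_cancel image_iff)
      then show ?thesis using that by (auto simp: dual_def E_def)
    qed
    then show "hcross (dual \<omega>) 0 n 1 n = hcross (?t ` (E - \<omega>)) 0 n 1 n"
      unfolding hcross_def by (intro joins_cong) blast
  qed
  also have "\<dots> = pr E (\<lambda>\<omega>. hcross (?t ` \<omega>) 0 n 1 n)"
    by (rule pr_Compl)
  also have "\<dots> = pr (?t ` E) (\<lambda>\<omega>. hcross \<omega> 0 n 1 n)"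
    by (rule pr_image[symmetric]) (auto simp: inj_on_def)
  also have "\<dots> = vprob n (n + 1)"
  proof -
    have "?R' \<subseteq> ?t ` E" by (auto simp: E_def image_image image_Un)
    then show ?thesis using fin by (subst pr_hcross) auto
  qed
  finally have "vprob n (n + 1) = pr E (\<lambda>\<omega>. hcross (dual \<omega>) 0 n 1 n)" by simp
  also have "\<dots> \<le> pr E (\<lambda>\<omega>. \<not> vcross \<omega> 1 n 1 (n + 1))"
    using not_vcross_and_dual_hcross by (intro pr_mono fin) blast
  also have "\<dots> = 1 - vprob n (n + 1)"
    using fin by (simp add: pr_not pr_vcross E_def)
  finally show ?thesis by simp
qed

section \<open>A Russo-Seymour-Welsh estimate\<close>

definition flip :: "int \<Rightarrow> site \<Rightarrow> site" where
  "flip k = (\<lambda>(x, y). (x, 2 * k + 1 - y))"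

text \<open>\<open>flip k\<close> exchanges the rows 1 to \<open>k\<close> with the rows
  \<open>k + 1\<close> to \<open>2 * k\<close>. Including the mirror image of \<open>W\<close> in
  the target leaves no way around on the left, since the \<open>W\<close> of a wall contains the
  lower half of the left side. It also gives the event a reflected partner of equal
  probability.\<close>

definition block :: "int \<Rightarrow> int \<Rightarrow> site set \<Rightarrow> site set \<Rightarrow> bool" where
  "block m k W \<omega> \<longleftrightarrow> \<not> joins \<omega> (rect 1 m 1 (2 * k) - W)
     ({1..m} \<times> {1} - W) ({1..m} \<times> {2 * k} \<union> flip k ` W)"

text \<open>In terms of the dual lattice: the square \<open>[1, k + 1] \<times> [1, k]\<close> is crossed vertically by an open
  dual path, with \<open>W\<close> on its left, which is connected by an open dual path to the right side of
  \<open>[1, m] \<times> [1, 2 k]\<close>. The natural choice of \<open>W\<close> is the cluster of the left side of the square, but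
  only the existence of some \<open>W\<close> is a decreasing event.\<close>

definition wall :: "int \<Rightarrow> int \<Rightarrow> site set \<Rightarrow> site set \<Rightarrow> bool" where
  "wall m k W \<omega> \<longleftrightarrow> W \<subseteq> rect 1 (k + 1) 1 k \<and> {1} \<times> {1..k} \<subseteq> W \<and> W \<inter> {k + 1} \<times> {1..k} = {} \<and>
     (\<forall>u\<in>W. \<forall>v\<in>rect 1 (k + 1) 1 k - W. adj u v \<longrightarrow> u + v \<notin> \<omega>) \<and> block m k W \<omega>"

definition cluster :: "int \<Rightarrow> site set \<Rightarrow> site set" where
  "cluster k \<omega> = {v \<in> rect 1 (k + 1) 1 k. \<exists>u\<in>{1} \<times> {1..k}. conn \<omega> (rect 1 (k + 1) 1 k) u v}"

lemma joinsI: "u \<in> A \<Longrightarrow> v \<in> B \<Longrightarrow> conn \<omega> R u v \<Longrightarrow> joins \<omega> R A B"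
  by (auto simp: joins_def)

lemma image_involution: "(\<And>x. f (f x) = x) \<Longrightarrow> f ` A \<subseteq> A \<Longrightarrow> f ` A = A"
  by (metis image_subset_iff image_eqI subsetI subset_antisym)

lemma flip_simp [simp]: "flip k (x, y) = (x, 2 * k + 1 - y)"
  by (simp add: flip_def)

lemma flip_flip [simp]: "flip k (flip k u) = u"
  by (cases u) simp

lemma mem_flip_image: "u \<in> flip k ` W \<longleftrightarrow> flip k u \<in> W"
  by (metis flip_flip image_iff)

lemma isom_flip: "isom (flip k) (\<lambda>(x, y). (x, 2 * (2 * k + 1) - y))"
  unfolding flip_def by (rule isom_flip_snd)

section \<open>Planar part: paths in a rectangle cut by a set and its mirror image\<close>

lemma conn_hline:
  assumes "{x1..x2} \<times> {y} \<subseteq> C" "x1 \<le> x2"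
  shows "conn UNIV C (x1, y) (x2, y)"
  using assms(2,1)
proof (induction rule: int_ge_induct)
  case (step i)
  have "conn UNIV C (x1, y) (i, y)" using step by force
  then show ?case by (rule conn_step) (use step in \<open>auto simp: adj_def\<close>)
qed simp

lemma conn_vline:
  assumes "{x} \<times> {y1..y2} \<subseteq> C" "y1 \<le> y2"
  shows "conn UNIV C (x, y1) (x, y2)"
  using assms(2,1)
proof (induction rule: int_ge_induct)
  case (step i)
  have "conn UNIV C (x, y1) (x, i)" using step by force
  then show ?case by (rule conn_step) (use step in \<open>auto simp: adj_def\<close>)
qed simp

text \<open>Stop the path just before it first enters \<open>F\<close>.\<close>

lemma reach_or_touch:
  assumes "conn \<omega> (R - A) u v" "u \<in> R - A - F"
  shows "(conn \<omega> (R - A - F) u v \<and> v \<in> R - A - F) \<or>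
    (\<exists>w z. conn \<omega> (R - A - F) u w \<and> w \<in> R - A - F \<and> z \<in> F \<and> adj w z)"
  using assms(1)
proof (induction rule: conn_induct)
  case refl
  then show ?case using assms by simp
next
  case (step v w)
  show ?case
  proof (cases "conn \<omega> (R - A - F) u v \<and> v \<in> R - A - F")
    case True
    show ?thesis
    proof (cases "w \<in> F")
      case True
      then show ?thesis using \<open>conn \<omega> (R - A - F) u v \<and> v \<in> R - A - F\<close> step.hyps by blast
    next
      case False
      then have "w \<in> R - A - F" using step.hyps by blast
      moreover have "conn \<omega> (R - A - F) u w"
        using True step.hyps \<open>w \<in> R - A - F\<close> by (intro conn_step[of \<omega> _ u v w]) auto
      ultimately show ?thesis by blast
    qed
  next
    case False
    then show ?thesis using step.IH by blast
  qed
qed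

text \<open>The ends of \<open>P\<close> (bottom, upper left) and of \<open>Q\<close> (lower left,
  top) alternate along the boundary of the rectangle. Prolonging both outside the rectangle brings
  them into the position of \<open>crossing_paths_meet\<close>.\<close>

lemma interlaced_paths_meet:
  assumes m: "1 \<le> m" and k: "1 \<le> k"
    and P: "P \<subseteq> rect 1 m 1 (2 * k)" "conn UNIV P (x1, 1) (1, y1)" "(x1, 1) \<in> P" "(1, y1) \<in> P" "k < y1"
    and Q: "Q \<subseteq> rect 1 m 1 (2 * k)" "conn UNIV Q (x2, 2 * k) (1, y2)" "(x2, 2 * k) \<in> Q" "(1, y2) \<in> Q" "y2 \<le> k"
  shows "P \<inter> Q \<noteq> {}"
proof
  assume PQ: "P \<inter> Q = {}"
  \<comment> \<open>\<open>Q\<close> is prolonged to the left up to column -1, and above the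
    rectangle to column \<open>m + 1\<close>; \<open>P\<close> is prolonged down to row 0, and along
    column 0 up to row \<open>2 * k + 2\<close>. In column 0 the two stay apart because
    \<open>y2 \<le> k < y1\<close>.\<close>
  define C1 where "C1 = Q \<union> {-1..0} \<times> {y2} \<union> {x2..m + 1} \<times> {2 * k + 1}"
  define C2 where "C2 = P \<union> {(x1, 0)} \<union> {0} \<times> {y1..2 * k + 2}"
  have r: "1 \<le> x1" "x1 \<le> m" "1 \<le> x2" "x2 \<le> m" "1 \<le> y1" "y1 \<le> 2 * k" "1 \<le> y2"
    using P Q by auto
  have Q1: "conn UNIV C1 (1, y2) (x2, 2 * k)"
    using conn_mono[OF conn_sym[OF Q(2)], of UNIV C1] by (auto simp: C1_def)
  have "conn UNIV C1 (-1, y2) (0, y2)"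
    by (rule conn_hline) (auto simp: C1_def)
  also have "conn UNIV C1 (0, y2) (1, y2)"
    using Q by (intro conn_edge) (auto simp: C1_def adj_def)
  finally have "conn UNIV C1 (-1, y2) (1, y2)" .
  also note Q1
  also have "conn UNIV C1 (x2, 2 * k) (x2, 2 * k + 1)"
    using Q r by (intro conn_edge) (auto simp: C1_def adj_def)
  also have "conn UNIV C1 (x2, 2 * k + 1) (m + 1, 2 * k + 1)"
    using r by (intro conn_hline) (auto simp: C1_def)
  finally have 1: "conn UNIV C1 (-1, y2) (m + 1, 2 * k + 1)" .
  have P1: "conn UNIV C2 (x1, 1) (1, y1)"
    using conn_mono[OF P(2), of UNIV C2] by (auto simp: C2_def)
  have "conn UNIV C2 (x1, 0) (x1, 1)"
    using P by (intro conn_edge) (auto simp: C2_def adj_def)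
  also note P1
  also have "conn UNIV C2 (1, y1) (0, y1)"
    using P r by (intro conn_edge) (auto simp: C2_def adj_def)
  also have "conn UNIV C2 (0, y1) (0, 2 * k + 2)"
    using r by (intro conn_vline) (auto simp: C2_def)
  finally have 2: "conn UNIV C2 (x1, 0) (0, 2 * k + 2)" .
  have "C1 \<inter> C2 \<noteq> {}"
  proof (rule crossing_paths_meet[OF 1 _ 2])
    show "\<forall>z\<in>C2. fst (- 1 :: int, y2) < fst z \<and> fst z < fst (m + 1, 2 * k + 1)"
      using P(1) r by (auto simp: C2_def rect_def)
    show "\<forall>z\<in>C1. snd (x1, 0 :: int) < snd z \<and> snd z < snd (0 :: int, 2 * k + 2)"
      using Q(1,5) r by (auto simp: C1_def rect_def)
  qed (use r in \<open>auto simp: C1_def C2_def\<close>)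
  moreover have "C1 \<inter> C2 = {}"
    using PQ P(1,5) Q(1,5) r unfolding C1_def C2_def rect_def by fastforce
  ultimately show False by blast
qed

text \<open>If neither set is hit, one of the two paths is already a vertical crossing. Otherwise
  the path from the bottom reaches the mirror image of \<open>A\<close> and continues through it to
  the upper left side, and the path from the top reaches \<open>A\<close> and the lower left side.
  These two must meet, necessarily off \<open>A\<close> and its mirror image, which again yields an
  open crossing.\<close>

lemma block_or_flipped_block:
  assumes m: "k + 1 \<le> m" and k: "1 \<le> k"
    and A: "A \<subseteq> rect 1 (k + 1) 1 k"
      "\<forall>a\<in>A. \<exists>u\<in>{1} \<times> {1..k}. u \<in> A \<and> conn UNIV A u a"
    and nb: "\<not> block m k A \<omega>"
    and nb': "joins \<omega> (rect 1 m 1 (2 * k) - flip k ` A)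
       ({1..m} \<times> {2 * k} - flip k ` A) ({1..m} \<times> {1} \<union> A)"
  shows "vcross \<omega> 1 m 1 (2 * k)"
proof -
  let ?R = "rect 1 m 1 (2 * k)" and ?F = "flip k ` A"
  define D where "D = ?R - A - ?F"
  have D': "?R - ?F - A = D" by (auto simp: D_def)
  have F: "?F \<subseteq> {1..k + 1} \<times> {k + 1..2 * k}"
    using A(1) by (auto simp: rect_def)
  have AR: "A \<subseteq> ?R" "?F \<subseteq> ?R"
    using A(1) F m k by (auto simp: rect_def)
  have vcrossI: ?thesis if "u \<in> {1..m} \<times> {1}" "v \<in> {1..m} \<times> {2 * k}" "conn \<omega> D u v" for u v
    unfolding vcross_def joins_def using that conn_mono[OF that(3), of \<omega> ?R] by (auto simp: D_def)
  obtain u1 v1 where 1: "u1 \<in> {1..m} \<times> {1} - A" "v1 \<in> {1..m} \<times> {2 * k} \<union> ?F" "conn \<omega> (?R - A) u1 v1"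
    using nb unfolding block_def joins_def by blast
  have u1: "u1 \<in> D" using 1(1) F k by (auto simp: D_def)
  obtain u2 v2 where 2: "u2 \<in> {1..m} \<times> {2 * k} - ?F" "v2 \<in> {1..m} \<times> {1} \<union> A" "conn \<omega> (?R - ?F) u2 v2"
    using nb' unfolding joins_def by blast
  have u2: "u2 \<in> D" using 2(1) A(1) k by (auto simp: D_def)
  show ?thesis
  proof (rule ccontr)
    assume no: "\<not> ?thesis"
    have "v1 \<notin> D \<or> \<not> conn \<omega> D u1 v1"
      using vcrossI[of u1 v1] 1 no by (auto simp: D_def)
    then obtain w1 z1 where w1: "conn \<omega> D u1 w1" "w1 \<in> D" "z1 \<in> ?F" "adj w1 z1"
      using reach_or_touch[OF 1(3), of ?F] u1 unfolding D_def[symmetric] by blast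
    have "v2 \<notin> D \<or> \<not> conn \<omega> D u2 v2"
      using vcrossI[of v2 u2] conn_sym[of \<omega> D u2 v2] 2 no by (auto simp: D_def)
    then obtain w2 z2 where w2: "conn \<omega> D u2 w2" "w2 \<in> D" "z2 \<in> A" "adj w2 z2"
      using reach_or_touch[OF 2(3), of A] u2 unfolding D' by blast
    \<comment> \<open>The open clusters of the two starting points off \<open>A\<close> and its
      mirror image; a common site would complete a vertical crossing.\<close>
    define B1 where "B1 = {v \<in> D. conn \<omega> D u1 v}"
    define B2 where "B2 = {v \<in> D. conn \<omega> D u2 v}"
    have B: "B1 \<inter> B2 = {}"
    proof -
      have False if "conn \<omega> D u1 v" "conn \<omega> D u2 v" for v
        using vcrossI[of u1 u2] conn_trans[OF that(1) conn_sym[OF that(2)]] 1(1) 2(1) no by blast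
      then show ?thesis unfolding B1_def B2_def by blast
    qed
    have reach: "conn UNIV {v \<in> D. conn \<omega> D u v} u w" if "conn \<omega> D u w" "u \<in> D" for u w
      using that(1)
    proof (induction rule: conn_induct)
      case (step v w)
      then show ?case
        using conn_step[of \<omega> D u v w] by (intro conn_step[of UNIV _ u v w]) auto
    qed simp
    obtain x1 where x1: "u1 = (x1, 1)" using 1(1) by (cases u1) auto
    obtain x2 where x2: "u2 = (x2, 2 * k)" using 2(1) by (cases u2) auto
    obtain y2 where y2: "(1, y2) \<in> A" "y2 \<le> k" "conn UNIV A (1, y2) z2"
      using A(2) w2(3) by fastforce
    obtain y where y: "(1, y) \<in> A" "y \<le> k" "conn UNIV A (1, y) (flip k z1)"
      using A(2) w1(3) unfolding mem_flip_image by fastforce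
    then have y1: "(1, 2 * k + 1 - y) \<in> ?F" "k < 2 * k + 1 - y"
      "conn UNIV ?F (1, 2 * k + 1 - y) z1"
      using conn_isom[OF isom_flip, of k UNIV A "(1, y)" "flip k z1"]
      by (auto simp: mem_flip_image elim: conn_mono)
    have c1: "conn UNIV (B1 \<union> ?F) (x1, 1) (1, 2 * k + 1 - y)"
    proof -
      have "conn UNIV (B1 \<union> ?F) u1 w1"
        using reach[OF w1(1) u1] by (auto simp: B1_def intro: conn_mono)
      moreover have "conn UNIV (B1 \<union> ?F) w1 z1"
        using w1 by (intro conn_edge) (auto simp: B1_def)
      moreover have "conn UNIV (B1 \<union> ?F) z1 (1, 2 * k + 1 - y)"
        using conn_sym[OF y1(3)] by (auto intro: conn_mono)
      ultimately show ?thesis unfolding x1 by (meson conn_trans)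
    qed
    have c2: "conn UNIV (B2 \<union> A) (x2, 2 * k) (1, y2)"
    proof -
      have "conn UNIV (B2 \<union> A) u2 w2"
        using reach[OF w2(1) u2] by (auto simp: B2_def intro: conn_mono)
      moreover have "conn UNIV (B2 \<union> A) w2 z2"
        using w2 by (intro conn_edge) (auto simp: B2_def)
      moreover have "conn UNIV (B2 \<union> A) z2 (1, y2)"
        using conn_sym[OF y2(3)] by (auto intro: conn_mono)
      ultimately show ?thesis unfolding x2 by (meson conn_trans)
    qed
    have "(B1 \<union> ?F) \<inter> (B2 \<union> A) \<noteq> {}"
    proof (rule interlaced_paths_meet[OF _ k _ c1 _ _ _ _ c2])
      show "1 \<le> m" using m k by simp
      show "B1 \<union> ?F \<subseteq> ?R" "B2 \<union> A \<subseteq> ?R" using AR unfolding B1_def B2_def D_def by blast+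
      show "(x1, 1) \<in> B1 \<union> ?F" "(x2, 2 * k) \<in> B2 \<union> A"
        using u1 u2 unfolding x1 x2 B1_def B2_def by simp_all
    qed (use y1 y2 in blast)+
    moreover have "(B1 \<union> ?F) \<inter> (B2 \<union> A) = {}"
    proof -
      have "A \<inter> ?F = {}" using F A(1) by (fastforce simp: rect_def)
      then show ?thesis using B unfolding B1_def B2_def D_def by blast
    qed
    ultimately show False by blast
  qed
qed

text \<open>Reflection in the horizontal midline gives the blocking event and its mirrored version
  the same probability, and one of them occurs whenever there is no vertical crossing.\<close>

lemma pr_block_ge:
  assumes m: "k + 1 \<le> m" and k: "1 \<le> k"
    and A: "A \<subseteq> rect 1 (k + 1) 1 k"
      "\<forall>a\<in>A. \<exists>u\<in>{1} \<times> {1..k}. u \<in> A \<and> conn UNIV A u a"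
    and E: "finite E" "bonds (rect 1 m 1 (2 * k)) \<subseteq> E"
  shows "(1 - vprob m (2 * k)) / 2 \<le> pr E (block m k A)"
proof -
  let ?R = "rect 1 m 1 (2 * k)" and ?F = "flip k ` A"
  let ?b' = "\<lambda>\<omega>. joins \<omega> (?R - ?F) ({1..m} \<times> {2 * k} - ?F) ({1..m} \<times> {1} \<union> A)"
  have "u \<in> flip k ` ?R \<longleftrightarrow> u \<in> ?R" "u \<in> flip k ` ({1..m} \<times> {1}) \<longleftrightarrow> u \<in> {1..m} \<times> {2 * k}"
    "u \<in> flip k ` ({1..m} \<times> {2 * k}) \<longleftrightarrow> u \<in> {1..m} \<times> {1}" for u
    unfolding mem_flip_image by (cases u; auto)+
  then have flip: "flip k ` ?R = ?R" "flip k ` ({1..m} \<times> {1}) = {1..m} \<times> {2 * k}"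
    "flip k ` ({1..m} \<times> {2 * k}) = {1..m} \<times> {1}" "flip k ` flip k ` A = A"
    by (blast, blast, blast, simp add: image_image)
  have inj: "inj (flip k)" by (metis flip_flip injI)
  have bonds: "bonds (?R - C) \<subseteq> E" for C
    using E bonds_mono[of "?R - C" ?R] by auto
  have "join_prob (?R - A) ({1..m} \<times> {1} - A) ({1..m} \<times> {2 * k} \<union> ?F) =
      join_prob (?R - ?F) ({1..m} \<times> {2 * k} - ?F) ({1..m} \<times> {1} \<union> A)"
    using join_prob_isom[OF isom_flip[of k], of "?R - A" "{1..m} \<times> {1} - A" "{1..m} \<times> {2 * k} \<union> ?F"]
    by (simp add: image_set_diff[OF inj] image_Un flip)
  then have eq: "pr E (block m k A) = 1 - pr E ?b'"
    unfolding block_def using E bonds by (simp add: pr_not pr_joins)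
  have "pr E (\<lambda>\<omega>. \<not> vcross \<omega> 1 m 1 (2 * k)) \<le> pr E (\<lambda>\<omega>. block m k A \<omega> \<or> \<not> ?b' \<omega>)"
    using block_or_flipped_block[OF m k A] by (intro pr_mono E) blast
  also have "\<dots> \<le> pr E (block m k A) + pr E (\<lambda>\<omega>. \<not> ?b' \<omega>)"
    by (intro pr_disj_le E)
  finally show ?thesis
    using E by (simp add: eq pr_not pr_vcross)
qed

text \<open>A path from the left side stays in the cluster \<open>A\<close>, so each of its steps
  uses a bond touching \<open>A\<close>; configurations agreeing on these bonds have the same such
  paths.\<close>

lemma determined_cluster:
  "determined {u + v | u v. u \<in> A \<and> v \<in> rect 1 (k + 1) 1 k \<and> adj u v} (\<lambda>\<omega>. cluster k \<omega> = A)"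
proof -
  let ?S = "rect 1 (k + 1) 1 k" and ?L = "{1} \<times> {1..k}"
  let ?E = "{u + v | u v. u \<in> A \<and> v \<in> ?S \<and> adj u v}"
  have *: "cluster k \<omega>' = A" if eq: "\<omega> \<inter> ?E = \<omega>' \<inter> ?E" and A: "cluster k \<omega> = A" for \<omega> \<omega>'
  proof
    have "v \<in> A" if "conn \<omega>' ?S u v" "u \<in> ?L" "u \<in> ?S" for u v
      using that(1)
    proof (induction rule: conn_induct)
      case refl
      show ?case using that(2,3) conn_refl unfolding A[symmetric] cluster_def by blast
    next
      case (step v w)
      then have "v + w \<in> \<omega>" using eq by blast
      moreover obtain u' where "u' \<in> ?L" "conn \<omega> ?S u' v"
        using step.IH unfolding A[symmetric] cluster_def by blast
      ultimately have "conn \<omega> ?S u' w" using step conn_step by blast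
      then show ?case using \<open>u' \<in> ?L\<close> step unfolding A[symmetric] cluster_def by blast
    qed
    then show "cluster k \<omega>' \<subseteq> A"
      unfolding cluster_def using conn_in by blast
    have "conn \<omega>' ?S u v" if "conn \<omega> ?S u v" "u \<in> ?L" "u \<in> ?S" for u v
      using that(1)
    proof (induction rule: conn_induct)
      case (step v w)
      then have "v \<in> A" using that(2) unfolding A[symmetric] cluster_def by blast
      then have "v + w \<in> \<omega>'" using eq step by blast
      then show ?case using step conn_step by blast
    qed simp
    then show "A \<subseteq> cluster k \<omega>'"
      unfolding A[symmetric] cluster_def using conn_in conn_refl by blast
  qed
  show ?thesis
    unfolding determined_def
    using *[of "\<omega> \<inter> ?E" \<omega> for \<omega>] *[of \<omega> "\<omega> \<inter> ?E" for \<omega>] by blast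
qed

text \<open>That the cluster of the left side is \<open>A\<close> depends only on the bonds touching \<open>A\<close>, whereas
  \<open>block m k A\<close> depends only on the other bonds.\<close>

lemma pr_wall_ge:
  assumes m: "k + 1 \<le> m" and k: "1 \<le> k"
    and E: "finite E" "bonds (rect 1 m 1 (2 * k)) \<subseteq> E"
  shows "(1 - vprob m (2 * k)) / 4 \<le> pr E (\<lambda>\<omega>. \<exists>W. wall m k W \<omega>)"
proof -
  let ?S = "rect 1 (k + 1) 1 k" and ?L = "{1 :: int} \<times> {1..k}" and ?R = "rect 1 m 1 (2 * k)"
  let ?E = "\<lambda>A. {u + v | u v. u \<in> A \<and> v \<in> ?S \<and> adj u v}"
  \<comment> \<open>The values of the cluster for which the square is not crossed. The last
    condition records that each site is linked to the left side within the set, as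
    \<open>pr_block_ge\<close> demands.\<close>
  define I where "I = {A. A \<subseteq> ?S \<and> ?L \<subseteq> A \<and> A \<inter> {k + 1} \<times> {1..k} = {} \<and>
    (\<forall>a\<in>A. \<exists>u\<in>?L. u \<in> A \<and> conn UNIV A u a)}"
  have finI: "finite I"
    by (rule finite_subset[of _ "Pow ?S"]) (auto simp: I_def)
  have SR: "?S \<subseteq> ?R" using m k by (auto simp: rect_def)
  have SE: "bonds ?S \<subseteq> E" using bonds_mono[OF SR] E by blast
  have clusterI: "cluster k \<omega> \<in> I \<longleftrightarrow> \<not> hcross \<omega> 1 (k + 1) 1 k" for \<omega>
  proof
    show "\<not> hcross \<omega> 1 (k + 1) 1 k" if "cluster k \<omega> \<in> I"
    proof
      assume "hcross \<omega> 1 (k + 1) 1 k"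
      then obtain u v where uv: "u \<in> ?L" "v \<in> {k + 1} \<times> {1..k}" "conn \<omega> ?S u v"
        unfolding hcross_def joins_def by blast
      then have "v \<in> cluster k \<omega>" unfolding cluster_def using k by auto
      then show False using that uv(2) unfolding I_def by blast
    qed
    assume nh: "\<not> hcross \<omega> 1 (k + 1) 1 k"
    have *: "u \<in> cluster k \<omega> \<and> conn UNIV (cluster k \<omega>) u v" if "u \<in> ?L" "conn \<omega> ?S u v" for u v
      using that(2)
    proof (induction rule: conn_induct)
      case refl
      have "u \<in> ?S" using that(1) k by auto
      then show ?case using that(1) conn_refl unfolding cluster_def by blast
    next
      case (step v w)
      have "v \<in> cluster k \<omega>" "w \<in> cluster k \<omega>"
        using step conn_step[of \<omega> ?S u v w] that(1) by (auto simp: cluster_def)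
      then show ?case using step by (auto intro: conn_step)
    qed
    have "\<exists>u\<in>?L. u \<in> cluster k \<omega> \<and> conn UNIV (cluster k \<omega>) u a" if a: "a \<in> cluster k \<omega>" for a
    proof -
      obtain u where "u \<in> ?L" "conn \<omega> ?S u a" using a unfolding cluster_def by blast
      then show ?thesis using * by blast
    qed
    moreover have "?L \<subseteq> cluster k \<omega>"
      using * conn_refl by blast
    moreover have "cluster k \<omega> \<inter> {k + 1} \<times> {1..k} = {}"
      using nh by (auto simp: cluster_def hcross_def joins_def)
    ultimately show "cluster k \<omega> \<in> I" by (auto simp: I_def cluster_def)
  qed
  have wall: "wall m k (cluster k \<omega>) \<omega>" if "cluster k \<omega> \<in> I" "block m k (cluster k \<omega>) \<omega>" for \<omega>
  proof -
    have "v \<in> cluster k \<omega>" if "u \<in> cluster k \<omega>" "v \<in> ?S" "adj u v" "u + v \<in> \<omega>" for u v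
      using that conn_step[of \<omega> ?S _ u v] by (auto simp: cluster_def)
    then show ?thesis using that by (auto simp: wall_def I_def)
  qed
  have summand: "(1 - vprob m (2 * k)) / 2 * pr E (\<lambda>\<omega>. cluster k \<omega> = A)
      \<le> pr E (\<lambda>\<omega>. cluster k \<omega> = A \<and> block m k (cluster k \<omega>) \<omega>)" if "A \<in> I" for A
  proof -
    have A: "A \<subseteq> ?S" "\<forall>a\<in>A. \<exists>u\<in>?L. u \<in> A \<and> conn UNIV A u a" using that by (auto simp: I_def)
    have "?E A \<inter> bonds (?R - A) = {}"
    proof -
      have False if "u \<in> A" "adj u v" "u' \<in> ?R - A" "v' \<in> ?R - A" "adj u' v'" "u + v = u' + v'" for u v u' v'
        using adj_add_eq[OF that(2,5,6)] that by blast
      then show ?thesis unfolding bonds_def by blast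
    qed
    moreover have "?E A \<subseteq> E" using A(1) SE unfolding bonds_def by blast
    moreover have "bonds (?R - A) \<subseteq> E" using bonds_mono[of "?R - A" ?R] E by blast
    ultimately have "pr E (\<lambda>\<omega>. cluster k \<omega> = A \<and> block m k A \<omega>) =
        pr E (\<lambda>\<omega>. cluster k \<omega> = A) * pr E (block m k A)"
      using E unfolding block_def
      by (intro pr_indep[of _ "?E A" "bonds (?R - A)"] determined_cluster determined_not determined_joins) auto
    moreover have "pr E (\<lambda>\<omega>. cluster k \<omega> = A \<and> block m k (cluster k \<omega>) \<omega>) =
        pr E (\<lambda>\<omega>. cluster k \<omega> = A \<and> block m k A \<omega>)"
      by (rule pr_cong) auto
    ultimately show ?thesis
      using mult_left_mono[OF pr_block_ge[OF m k A E] pr_nonneg[of E "\<lambda>\<omega>. cluster k \<omega> = A"]]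
      by (simp add: mult.commute)
  qed
  \<comment> \<open>One factor 1/2 comes from \<open>pr_block_ge\<close>, the other from
    self-duality: the square has \<open>k + 1\<close> by \<open>k\<close> sites and is crossed
    horizontally with probability \<open>vprob k (k + 1)\<close>.\<close>
  have "(1 - vprob m (2 * k)) / 4 \<le> (1 - vprob m (2 * k)) / 2 * (1 - vprob k (k + 1))"
    using vprob_self_dual[of k] vprob_le_1[of m "2 * k"]
      mult_left_mono[of "1 / 2" "1 - vprob k (k + 1)" "(1 - vprob m (2 * k)) / 2"] by simp
  also have "1 - vprob k (k + 1) = pr E (\<lambda>\<omega>. cluster k \<omega> \<in> I \<and> True)"
    unfolding clusterI using E SE by (simp add: pr_not pr_hcross)
  also have "(1 - vprob m (2 * k)) / 2 * \<dots> =
      (\<Sum>A\<in>I. (1 - vprob m (2 * k)) / 2 * pr E (\<lambda>\<omega>. cluster k \<omega> = A))"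
    using pr_sum[OF E(1) finI, of "cluster k" "\<lambda>_. True"] by (simp add: sum_distrib_left)
  also have "\<dots> \<le> (\<Sum>A\<in>I. pr E (\<lambda>\<omega>. cluster k \<omega> = A \<and> block m k (cluster k \<omega>) \<omega>))"
    by (intro sum_mono summand)
  also have "\<dots> = pr E (\<lambda>\<omega>. cluster k \<omega> \<in> I \<and> block m k (cluster k \<omega>) \<omega>)"
    by (rule pr_sum[OF E(1) finI, symmetric])
  also have "\<dots> \<le> pr E (\<lambda>\<omega>. \<exists>W. wall m k W \<omega>)"
    using wall by (intro pr_mono E) blast
  finally show ?thesis .
qed

lemma decreasing_wall: "decreasing (\<lambda>\<omega>. \<exists>W. wall m k W \<omega>)"
proof -
  have "wall m k W \<alpha>" if "wall m k W \<beta>" "\<alpha> \<subseteq> \<beta>" for W \<alpha> \<beta>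
  proof -
    have "joins \<beta> R A B" if "joins \<alpha> R A B" for R A B
      using that \<open>\<alpha> \<subseteq> \<beta>\<close> by (auto intro: joins_mono)
    then have "block m k W \<alpha>"
      using that unfolding wall_def block_def by blast
    then show ?thesis using that unfolding wall_def by blast
  qed
  then show ?thesis unfolding decreasing_def by blast
qed

section \<open>Two mirrored walls block a longer rectangle\<close>

lemma wall_subset: "wall m k W \<omega> \<Longrightarrow> W \<subseteq> rect 1 k 1 k"
proof
  fix u assume "wall m k W \<omega>" "u \<in> W"
  then have "u \<in> rect 1 (k + 1) 1 k" "u \<notin> {k + 1} \<times> {1..k}"
    unfolding wall_def by blast+
  then show "u \<in> rect 1 k 1 k" by (cases u) auto
qed

text \<open>The path never leaves \<open>rect 1 m 1 (2 * k) - W\<close>. Column 1 is covered by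
  \<open>W\<close> and its mirror image, so there is no exit to the left; inside the square the
  bonds leading into \<open>W\<close> are closed; and \<open>W\<close> can be entered from outside
  the square only through a site of its mirror image, which \<open>block\<close> makes
  unreachable.\<close>

lemma wall_barrier:
  assumes W: "wall m k W \<omega>" and k: "1 \<le> k"
    and uv: "conn \<omega> (rect l m 1 (2 * k)) u v" "u \<in> {1..m} \<times> {1} - W"
  shows "snd v \<noteq> 2 * k"
proof -
  let ?R = "rect 1 m 1 (2 * k)" and ?S = "rect 1 (k + 1) 1 k"
  have blocked: "v \<notin> {1..m} \<times> {2 * k} \<union> flip k ` W" if "conn \<omega> (?R - W) u v" for v
    using W that uv(2) unfolding wall_def block_def joins_def by blast
  have left: "(1, j) \<in> W" if "1 \<le> j" "j \<le> k" for j
    using W that unfolding wall_def by auto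
  have *: "conn \<omega> (?R - W) u v \<and> v \<in> ?R - W"
    using uv(1)
  proof (induction rule: conn_induct)
    case refl
    then show ?case using uv(2) k by auto
  next
    case (step v w)
    obtain x y x' y' where xy: "v = (x, y)" "w = (x', y')" by (cases v; cases w)
    from step.IH have v: "conn \<omega> (?R - W) u v" "1 \<le> x" "x \<le> m" "1 \<le> y" "y \<le> 2 * k" "v \<notin> W"
      by (auto simp: xy)
    have nF: "(x, 2 * k + 1 - y) \<notin> W" using blocked[OF v(1)] by (auto simp: xy mem_flip_image)
    have "x \<noteq> 1"
    proof
      assume "x = 1"
      have "(x, y) \<in> W \<or> (x, 2 * k + 1 - y) \<in> W"
        using left[of y] left[of "2 * k + 1 - y"] v \<open>x = 1\<close> by (cases "y \<le> k") simp_all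
      then show False using v nF by (simp add: xy)
    qed
    then have wR: "w \<in> ?R" using step.hyps v by (auto simp: xy adj_def)
    have "w \<notin> W"
    proof
      assume w: "w \<in> W"
      then have wS: "1 \<le> x'" "x' \<le> k" "1 \<le> y'" "y' \<le> k"
        using W unfolding wall_def xy by force+
      have "v \<notin> ?S"
        using W w step.hyps v(6) unfolding wall_def by (metis DiffI add.commute adj_sym)
      \<comment> \<open>\<open>W\<close> avoids column \<open>k + 1\<close>, so a neighbour of
        \<open>w\<close> outside the square lies directly above row \<open>k\<close>; it is then the
        mirror image of \<open>w\<close> itself.\<close>
      then have "x = x'" "y = k + 1" "y' = k"
        using wS v step.hyps by (auto simp: xy adj_def)
      then show False using nF w by (simp add: xy)
    qed
    then show ?case using wR step v by (auto intro: conn_step)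
  qed
  then show ?thesis using blocked[of v] by (cases v) auto
qed

text \<open>One wall stops the paths starting in columns 1 to \<open>m\<close> outside
  \<open>W1\<close>, the other one their mirror images. A remaining path starts between the two
  vertical dual paths in the common square. The closed bonds around both sets keep it there, and by
  \<open>H\<close> it cannot leave through the top of the square. In dual terms, \<open>H\<close>
  joins the two walls by a horizontal dual path.\<close>

lemma walls_block:
  fixes m k :: int
  defines "\<sigma> \<equiv> \<lambda>(x, y). (k + 2 - x, y :: int)" and "\<tau> \<equiv> \<lambda>(x, y). (2 * (k + 2) - x, y :: int)"
  assumes m: "k + 1 \<le> m" and k: "1 \<le> k"
    and W1: "wall m k W1 \<omega>" and W2: "wall m k W2 (\<tau> ` \<omega>)" and H: "\<not> vcross \<omega> 2 k 1 k"
  shows "\<not> vcross \<omega> (k + 2 - m) m 1 (2 * k)"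
proof
  assume "vcross \<omega> (k + 2 - m) m 1 (2 * k)"
  then obtain u v where uv: "u \<in> {k + 2 - m..m} \<times> {1}" "v \<in> {k + 2 - m..m} \<times> {2 * k}"
    "conn \<omega> (rect (k + 2 - m) m 1 (2 * k)) u v"
    by (auto simp: vcross_def joins_def)
  let ?B = "rect (k + 2 - m) m 1 (2 * k)" and ?S = "rect 1 (k + 1) 1 k"
  have iso: "isom \<sigma> \<tau>" unfolding \<sigma>_def \<tau>_def by (rule isom_flip_fst)
  have \<sigma>B: "\<sigma> ` ?B = ?B"
  proof -
    have "\<sigma> (\<sigma> u) = u" for u by (cases u) (simp add: \<sigma>_def)
    moreover have "\<sigma> ` ?B \<subseteq> ?B" by (auto simp: \<sigma>_def)
    ultimately show ?thesis by (rule image_involution)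
  qed
  have sv: "snd v = 2 * k" "snd (\<sigma> v) = 2 * k"
    using uv(2) by (auto simp: \<sigma>_def)
  have "u \<notin> {1..m} \<times> {1} - W1"
    using wall_barrier[OF W1 k uv(3)] sv by blast
  moreover have "conn (\<tau> ` \<omega>) ?B (\<sigma> u) (\<sigma> v)"
    using conn_isom[OF iso, of \<omega> ?B u v] uv(3) unfolding \<sigma>B by simp
  then have "\<sigma> u \<notin> {1..m} \<times> {1} - W2"
    using wall_barrier[OF W2 k, of "k + 2 - m" "\<sigma> u" "\<sigma> v"] sv(2) by metis
  moreover obtain x where x: "u = (x, 1)" "k + 2 - m \<le> x" "x \<le> m" using uv(1) by (cases u) auto
  moreover have \<sigma>u: "\<sigma> u = (k + 2 - x, 1)" using x by (simp add: \<sigma>_def)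
  ultimately have "1 \<le> x \<longrightarrow> u \<in> W1" "x \<le> k + 1 \<longrightarrow> \<sigma> u \<in> W2"
    by auto
  moreover have WS: "W1 \<subseteq> rect 1 k 1 k" "W2 \<subseteq> rect 1 k 1 k"
    using W1 W2 by (auto dest: wall_subset)
  then have "(x, 1) \<in> W1 \<longrightarrow> x \<le> k" "(k + 2 - x, 1) \<in> W2 \<longrightarrow> 2 \<le> x"
    by auto
  then have "u \<in> W1 \<longrightarrow> x \<le> k" "\<sigma> u \<in> W2 \<longrightarrow> 2 \<le> x"
    by (simp_all only: x(1)[symmetric] \<sigma>u[symmetric])
  ultimately have u: "u \<in> W1" "\<sigma> u \<in> W2" using k by linarith+
  \<comment> \<open>\<open>W1\<close> lies in columns up to \<open>k\<close> and the mirror image of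
    \<open>W2\<close> in columns from 2 on, so the confined path lives in the rectangle of
    \<open>H\<close>.\<close>
  have "v \<in> W1 \<and> \<sigma> v \<in> W2 \<and> conn \<omega> (rect 2 k 1 k) u v"
    using uv(3)
  proof (induction rule: conn_induct)
    case refl
    show ?case using u by simp
  next
    case (step v w)
    obtain x y x' y' where xy: "v = (x, y)" "w = (x', y')" by (cases v; cases w)
    have x: "2 \<le> x" "x \<le> k" "1 \<le> y" "y \<le> k"
      using step.IH WS by (force simp: \<sigma>_def xy)+
    have "w \<in> ?S"
    proof (rule ccontr)
      assume "w \<notin> ?S"
      then have "y = k" using x step.hyps by (auto simp: xy adj_def)
      moreover have "snd u = 1" using uv(1) by auto
      moreover have "2 \<le> fst u" "fst u \<le> k" using u WS by (cases u; force simp: \<sigma>_def)+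
      ultimately show False
        using H step.IH x unfolding vcross_def joins_def xy by (cases u) force
    qed
    then have w: "w \<in> W1"
      using W1 step unfolding wall_def by blast
    have "\<sigma> w \<in> ?S" using \<open>w \<in> ?S\<close> by (auto simp: \<sigma>_def xy)
    moreover have "adj (\<sigma> v) (\<sigma> w)" "\<sigma> v + \<sigma> w \<in> \<tau> ` \<omega>"
      using step by (auto simp: isom_adj[OF iso] isom_add[OF iso])
    ultimately have w': "\<sigma> w \<in> W2"
      using W2 step.IH unfolding wall_def by blast
    have "w \<in> rect 2 k 1 k" using w w' WS by (force simp: \<sigma>_def xy)
    then show ?case
      using w w' step x by (auto simp: xy intro: conn_step)
  qed
  then show False using WS(1) uv(2) k by force
qed

text \<open>The new width is that of the union of \<open>[1, m]\<close> and its mirror image, which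
  overlap in the columns 1 to \<open>k + 1\<close> of the square. With
  \<open>b = 1 - vprob m (2 * k)\<close>, Harris' inequality combines two walls of probability at
  least \<open>b / 4\<close> each with an event of probability at least 1/2, whence the 32.\<close>

lemma rsw_step:
  assumes m: "k + 1 \<le> m" and k: "1 \<le> k"
  shows "(1 - vprob m (2 * k))\<^sup>2 / 32 \<le> 1 - vprob (2 * m - k - 1) (2 * k)"
proof -
  define \<tau> :: "site \<Rightarrow> site" where "\<tau> = (\<lambda>(x, y). (2 * (k + 2) - x, y))"
  define \<sigma> :: "site \<Rightarrow> site" where "\<sigma> = (\<lambda>(x, y). (k + 2 - x, y))"
  let ?B = "rect (k + 2 - m) m 1 (2 * k)"
  define E where "E = bonds ?B"
  let ?Y = "\<lambda>\<omega>. \<exists>W. wall m k W \<omega>" and ?H = "\<lambda>\<omega>. \<not> vcross \<omega> 2 k 1 k"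
  let ?b = "1 - vprob m (2 * k)"
  have iso: "isom \<sigma> \<tau>" unfolding \<sigma>_def \<tau>_def by (rule isom_flip_fst)
  have E: "finite E" by (simp add: E_def finite_bonds)
  have sub: "bonds R \<subseteq> E" if "R \<subseteq> ?B" for R using that bonds_mono by (simp add: E_def)
  have Y: "?b / 4 \<le> pr E ?Y"
    using m k by (intro pr_wall_ge E sub) (auto simp: rect_def)
  have "\<tau> ` E = E"
  proof -
    have "\<sigma> ` ?B = ?B"
      by (rule image_involution) (auto simp: \<sigma>_def)
    then show ?thesis unfolding E_def using bonds_isom[OF iso, of ?B] by simp
  qed
  then have "pr E (\<lambda>\<omega>. ?Y (\<tau> ` \<omega>)) = pr E ?Y"
    using pr_image[of \<tau> E ?Y] iso by (metis inj_on_subset isom_def subset_UNIV)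
  then have Y': "?b / 4 \<le> pr E (\<lambda>\<omega>. ?Y (\<tau> ` \<omega>))" using Y by simp
  have "bonds (rect 2 k 1 k) \<subseteq> E" using m k by (intro sub) (auto simp: rect_def)
  then have "pr E ?H = 1 - vprob (k - 1) k"
    using E pr_vcross[OF E, of 2 k 1 k] by (simp add: pr_not)
  then have H: "1 / 2 \<le> pr E ?H" using vprob_self_dual[of "k - 1"] by simp
  have dY': "decreasing (\<lambda>\<omega>. ?Y (\<tau> ` \<omega>))"
    using decreasing_wall[of m k] unfolding decreasing_def by (meson image_mono)
  have dH: "decreasing ?H" unfolding vcross_def by (rule decreasing_not_joins)
  have dYY: "decreasing (\<lambda>\<omega>. ?Y \<omega> \<and> ?Y (\<tau> ` \<omega>))"
    using decreasing_wall[of m k] dY' unfolding decreasing_def by blast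
  have b: "0 \<le> ?b" using vprob_le_1[of m "2 * k"] by simp
  have "?b\<^sup>2 / 32 = ?b / 4 * (?b / 4) * (1 / 2)" by (simp add: power2_eq_square)
  also have "\<dots> \<le> pr E ?Y * pr E (\<lambda>\<omega>. ?Y (\<tau> ` \<omega>)) * pr E ?H"
    using Y Y' H b by (intro mult_mono) (auto simp: pr_nonneg)
  also have "\<dots> \<le> pr E (\<lambda>\<omega>. ?Y \<omega> \<and> ?Y (\<tau> ` \<omega>)) * pr E ?H"
    by (intro mult_right_mono harris_inequality E decreasing_wall dY' pr_nonneg)
  also have "\<dots> \<le> pr E (\<lambda>\<omega>. (?Y \<omega> \<and> ?Y (\<tau> ` \<omega>)) \<and> ?H \<omega>)"
    by (intro harris_inequality E dYY dH)
  also have "\<dots> \<le> pr E (\<lambda>\<omega>. \<not> vcross \<omega> (k + 2 - m) m 1 (2 * k))"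
    using walls_block[OF m k] unfolding \<tau>_def by (intro pr_mono E) blast
  also have "\<dots> = 1 - vprob (2 * m - k - 1) (2 * k)"
    using E pr_vcross[OF E, of "k + 2 - m" m 1 "2 * k"] by (simp add: pr_not E_def algebra_simps)
  finally show ?thesis .
qed

text \<open>Self-duality gives 1/2 at width \<open>2 * k - 1\<close>. Three steps lead to the widths
  \<open>3 * k - 3\<close>, \<open>5 * k - 7\<close> and \<open>9 * k - 15\<close>, with exponents
  7, 19 and 43, each being twice the previous one plus 5. The width \<open>6 * k + 1\<close> is the
  length of a strip of an annulus; \<open>6 \<le> k\<close> ensures
  \<open>6 * k + 1 \<le> 9 * k - 15\<close>.\<close>

lemma rsw:
  assumes k: "6 \<le> k"
  shows "1 / 2 ^ 43 \<le> 1 - vprob (6 * k + 1) (2 * k)"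
proof -
  have step: "x\<^sup>2 / 32 \<le> 1 - vprob (2 * m - k - 1) (2 * k)"
    if "x \<le> 1 - vprob m (2 * k)" "0 \<le> x" "k + 1 \<le> m" for x m
  proof -
    have "x\<^sup>2 / 32 \<le> (1 - vprob m (2 * k))\<^sup>2 / 32"
      using that by (intro divide_right_mono power_mono) auto
    also have "\<dots> \<le> 1 - vprob (2 * m - k - 1) (2 * k)"
      using that(3) k by (intro rsw_step) auto
    finally show ?thesis .
  qed
  have "1 / 2 \<le> 1 - vprob (2 * k - 1) (2 * k)"
    using vprob_self_dual[of "2 * k - 1"] by simp
  from step[OF this] have "1 / 2 ^ 7 \<le> 1 - vprob (2 * (2 * k - 1) - k - 1) (2 * k)"
    using k by (simp add: power_divide)
  from step[OF this] have "1 / 2 ^ 19 \<le> 1 - vprob (2 * (2 * (2 * k - 1) - k - 1) - k - 1) (2 * k)"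
    using k by (simp add: power_divide)
  from step[OF this] have "1 / 2 ^ 43 \<le>
      1 - vprob (2 * (2 * (2 * (2 * k - 1) - k - 1) - k - 1) - k - 1) (2 * k)"
    using k by (simp add: power_divide)
  also have "2 * (2 * (2 * (2 * k - 1) - k - 1) - k - 1) - k - 1 = 9 * k - 15"
    by simp
  finally have "1 / 2 ^ 43 \<le> 1 - vprob (9 * k - 15) (2 * k)" .
  then show ?thesis using vprob_mono[of "6 * k + 1" "9 * k - 15" "2 * k"] k by linarith
qed

section \<open>Long open paths are unlikely\<close>

abbreviation square :: "int \<Rightarrow> site set" where
  "square k \<equiv> rect (- k) k (- k) k"

text \<open>The four overlapping strips that make up the annulus between \<open>square k\<close> and
  \<open>square (3 * k)\<close>, each of \<open>6 * k + 1\<close> by \<open>2 * k\<close> sites and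
  crossed the short way.\<close>

definition across :: "int \<Rightarrow> site set \<Rightarrow> bool" where
  "across k \<omega> \<longleftrightarrow> hcross \<omega> (k + 1) (3 * k) (- 3 * k) (3 * k) \<or> hcross \<omega> (- 3 * k) (- k - 1) (- 3 * k) (3 * k)
    \<or> vcross \<omega> (- 3 * k) (3 * k) (k + 1) (3 * k) \<or> vcross \<omega> (- 3 * k) (3 * k) (- 3 * k) (- k - 1)"

text \<open>Harris' inequality for four blocked strips; 172 is 4 times 43.\<close>

lemma pr_across_le:
  assumes k: "6 \<le> k" and E: "finite E" "bonds (square (3 * k)) \<subseteq> E"
  shows "pr E (across k) \<le> 1 - 1 / 2 ^ 172"
proof -
  let ?P1 = "\<lambda>\<omega>. \<not> hcross \<omega> (k + 1) (3 * k) (- 3 * k) (3 * k)"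
  let ?P2 = "\<lambda>\<omega>. \<not> hcross \<omega> (- 3 * k) (- k - 1) (- 3 * k) (3 * k)"
  let ?P3 = "\<lambda>\<omega>. \<not> vcross \<omega> (- 3 * k) (3 * k) (k + 1) (3 * k)"
  let ?P4 = "\<lambda>\<omega>. \<not> vcross \<omega> (- 3 * k) (3 * k) (- 3 * k) (- k - 1)"
  have sub: "bonds R \<subseteq> E" if "R \<subseteq> square (3 * k)" for R using that bonds_mono E by blast
  have sub4: "rect (k + 1) (3 * k) (- 3 * k) (3 * k) \<subseteq> square (3 * k)"
    "rect (- 3 * k) (- k - 1) (- 3 * k) (3 * k) \<subseteq> square (3 * k)"
    "rect (- 3 * k) (3 * k) (k + 1) (3 * k) \<subseteq> square (3 * k)"
    "rect (- 3 * k) (3 * k) (- 3 * k) (- k - 1) \<subseteq> square (3 * k)"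
    using k by (auto simp: rect_def)
  have p: "1 / 2 ^ 43 \<le> pr E ?P1" "1 / 2 ^ 43 \<le> pr E ?P2" "1 / 2 ^ 43 \<le> pr E ?P3" "1 / 2 ^ 43 \<le> pr E ?P4"
    using rsw[OF k] pr_hcross[OF E(1) sub[OF sub4(1)]] pr_hcross[OF E(1) sub[OF sub4(2)]]
      pr_vcross[OF E(1) sub[OF sub4(3)]] pr_vcross[OF E(1) sub[OF sub4(4)]]
    by (simp_all add: pr_not[OF E(1)])
  have d: "decreasing ?P1" "decreasing ?P2" "decreasing ?P3" "decreasing ?P4"
    unfolding hcross_def vcross_def by (rule decreasing_not_joins)+
  have conj: "decreasing (\<lambda>\<omega>. P \<omega> \<and> Q \<omega>)" if "decreasing P" "decreasing Q" for P Q :: "site set \<Rightarrow> bool"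
    using that unfolding decreasing_def by blast
  have mult: "x * y \<le> pr E (\<lambda>\<omega>. P \<omega> \<and> Q \<omega>)"
    if "x \<le> pr E P" "y \<le> pr E Q" "0 \<le> x" "0 \<le> y" "decreasing P" "decreasing Q" for x y P Q
    using harris_inequality[OF E(1) that(5,6)] that mult_mono[of x "pr E P" y "pr E Q"]
    by (simp add: pr_nonneg)
  have "1 / 2 ^ 43 * (1 / 2 ^ 43) * (1 / 2 ^ 43 * (1 / 2 ^ 43))
      \<le> pr E (\<lambda>\<omega>. (?P1 \<omega> \<and> ?P2 \<omega>) \<and> (?P3 \<omega> \<and> ?P4 \<omega>))"
    by (intro mult conj p d) simp_all
  also have "\<dots> = pr E (\<lambda>\<omega>. \<not> across k \<omega>)"
    by (intro pr_cong) (auto simp: across_def)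
  also have "\<dots> = 1 - pr E (across k)"
    by (rule pr_not) fact
  finally show ?thesis by simp
qed

lemma determined_across: "determined (bonds (square (3 * k) - square k)) (across k)"
proof -
  have det: "determined (bonds (square (3 * k) - square k)) (\<lambda>\<omega>. joins \<omega> (rect a b c d) A B)"
    if "rect a b c d \<subseteq> square (3 * k) - square k" for a b c d A B
    by (intro determined_joins bonds_mono that)
  have disj: "determined F (\<lambda>\<omega>. P \<omega> \<or> Q \<omega>)" if "determined F P" "determined F Q"
    for F and P Q :: "site set \<Rightarrow> bool"
    using that by (simp add: determined_def)
  show ?thesis
    unfolding across_def [abs_def] hcross_def vcross_def
    by (intro disj det) (auto simp: rect_def)
qed

text \<open>Keep the part of the path after its last rise above level \<open>k\<close>. The function
  \<open>g\<close> will be one of the four signed coordinates.\<close>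

lemma coordinate_crossing:
  fixes g :: "site \<Rightarrow> int"
  assumes g: "\<And>u v. adj u v \<Longrightarrow> \<bar>g u - g v\<bar> \<le> 1"
    and "conn \<omega> B u v" "g u \<le> k" "k < g v"
  shows "\<exists>w. g w = k + 1 \<and> w \<in> B \<and> v \<in> B \<and> conn \<omega> {z \<in> B. k < g z} w v"
proof -
  have "k < g v \<longrightarrow> ?thesis"
    using assms(2)
  proof (induction rule: conn_induct)
    case refl
    then show ?case using assms(3) by simp
  next
    case (step v w)
    show ?case
    proof
      assume w: "k < g w"
      show "\<exists>x. g x = k + 1 \<and> x \<in> B \<and> w \<in> B \<and> conn \<omega> {z \<in> B. k < g z} x w"
      proof (cases "k < g v")
        case True
        then obtain x where x: "g x = k + 1" "x \<in> B" "conn \<omega> {z \<in> B. k < g z} x v"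
          using step.IH by blast
        then have "conn \<omega> {z \<in> B. k < g z} x w"
          using step.hyps True w by (intro conn_step[OF x(3)]) auto
        then show ?thesis using x step by blast
      next
        case False
        then have "g w = k + 1" using g[OF \<open>adj v w\<close>] w by linarith
        then show ?thesis using step by auto
      qed
    qed
  qed
  then show ?thesis using assms(4) by blast
qed

text \<open>Cut the path at the boundary of the outer square. There one signed coordinate equals
  \<open>3 * k\<close>, while it is at most \<open>k\<close> at the start, so
  \<open>coordinate_crossing\<close> produces a crossing of the corresponding strip.\<close>

lemma across_if_conn:
  assumes k: "1 \<le> k" and uv: "conn \<omega> UNIV u v" "u \<in> square k" "v \<notin> square (3 * k)"
  shows "across k \<omega>"
proof -
  let ?B = "square (3 * k)"
  have "(v \<in> ?B \<and> conn \<omega> ?B u v) \<or>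
      (\<exists>w. conn \<omega> ?B u w \<and> w \<in> ?B \<and> (\<bar>fst w\<bar> = 3 * k \<or> \<bar>snd w\<bar> = 3 * k))"
    using uv(1)
  proof (induction rule: conn_induct)
    case refl
    then show ?case using uv(2) k by (auto simp: rect_def)
  next
    case (step v w)
    then show ?case
    proof (elim disjE conjE)
      assume v: "v \<in> ?B" "conn \<omega> ?B u v"
      show ?case
      proof (cases "w \<in> ?B")
        case True
        then show ?thesis using v step conn_step by blast
      next
        case False
        then have "\<bar>fst v\<bar> = 3 * k \<or> \<bar>snd v\<bar> = 3 * k"
          using v(1) \<open>adj v w\<close> by (cases v; cases w) (auto simp: adj_def)
        then show ?thesis using v by blast
      qed
    qed blast
  qed
  then obtain w where w: "conn \<omega> ?B u w" "w \<in> ?B" "\<bar>fst w\<bar> = 3 * k \<or> \<bar>snd w\<bar> = 3 * k"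
    using uv(3) by blast
  have cross: "\<exists>x. x \<in> ?B \<and> g x = k + 1 \<and> conn \<omega> {z \<in> ?B. k < g z} x w"
    if "\<And>u v. adj u v \<Longrightarrow> \<bar>g u - g v\<bar> \<le> 1" "g u \<le> k" "g w = 3 * k" for g
  proof -
    have "k < g w" using that(3) k by simp
    then show ?thesis using coordinate_crossing[of g, OF that(1) w(1) that(2)] by blast
  qed
  have g: "\<bar>fst u - fst v\<bar> \<le> 1" "\<bar>- fst u - - fst v\<bar> \<le> 1" "\<bar>snd u - snd v\<bar> \<le> 1" "\<bar>- snd u - - snd v\<bar> \<le> 1"
    if "adj u v" for u v using that unfolding adj_def by linarith+
  have u: "fst u \<le> k" "- fst u \<le> k" "snd u \<le> k" "- snd u \<le> k" using uv(2) by (cases u; auto)+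
  from w(3) k consider "fst w = 3 * k" | "- fst w = 3 * k" | "snd w = 3 * k" | "- snd w = 3 * k"
    by linarith
  then show ?thesis
  proof cases
    case 1
    have "{z \<in> ?B. k < fst z} = rect (k + 1) (3 * k) (- 3 * k) (3 * k)" using k by (auto simp: rect_def)
    with cross[OF g(1) u(1) 1] obtain x where
      "x \<in> ?B" "fst x = k + 1" "conn \<omega> (rect (k + 1) (3 * k) (- 3 * k) (3 * k)) x w" by auto
    then have "hcross \<omega> (k + 1) (3 * k) (- 3 * k) (3 * k)"
      unfolding hcross_def by (intro joinsI[of x _ w]) (use 1 w(2) in \<open>auto simp: rect_def\<close>)
    then show ?thesis by (simp add: across_def)
  next
    case 2
    have "{z \<in> ?B. k < - fst z} = rect (- 3 * k) (- k - 1) (- 3 * k) (3 * k)" using k by (auto simp: rect_def)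
    with cross[OF g(2) u(2) 2] obtain x where
      "x \<in> ?B" "- fst x = k + 1" "conn \<omega> (rect (- 3 * k) (- k - 1) (- 3 * k) (3 * k)) x w"
      by auto
    note conn_sym[OF this(3)]
    with \<open>x \<in> ?B\<close> \<open>- fst x = k + 1\<close> have "hcross \<omega> (- 3 * k) (- k - 1) (- 3 * k) (3 * k)"
      unfolding hcross_def by (intro joinsI[of w _ x]) (use 2 w(2) in \<open>auto simp: rect_def\<close>)
    then show ?thesis by (simp add: across_def)
  next
    case 3
    have "{z \<in> ?B. k < snd z} = rect (- 3 * k) (3 * k) (k + 1) (3 * k)" using k by (auto simp: rect_def)
    with cross[OF g(3) u(3) 3] obtain x where
      "x \<in> ?B" "snd x = k + 1" "conn \<omega> (rect (- 3 * k) (3 * k) (k + 1) (3 * k)) x w" by auto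
    then have "vcross \<omega> (- 3 * k) (3 * k) (k + 1) (3 * k)"
      unfolding vcross_def by (intro joinsI[of x _ w]) (use 3 w(2) in \<open>auto simp: rect_def\<close>)
    then show ?thesis by (simp add: across_def)
  next
    case 4
    have "{z \<in> ?B. k < - snd z} = rect (- 3 * k) (3 * k) (- 3 * k) (- k - 1)" using k by (auto simp: rect_def)
    with cross[OF g(4) u(4) 4] obtain x where
      "x \<in> ?B" "- snd x = k + 1" "conn \<omega> (rect (- 3 * k) (3 * k) (- 3 * k) (- k - 1)) x w"
      by auto
    note conn_sym[OF this(3)]
    with \<open>x \<in> ?B\<close> \<open>- snd x = k + 1\<close> have "vcross \<omega> (- 3 * k) (3 * k) (- 3 * k) (- k - 1)"
      unfolding vcross_def by (intro joinsI[of w _ x]) (use 4 w(2) in \<open>auto simp: rect_def\<close>)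
    then show ?thesis by (simp add: across_def)
  qed
qed

text \<open>The events at the smaller scales depend only on bonds inside
  \<open>square (K * 3 ^ J)\<close>, and the next annulus lies outside this square, so the
  probabilities multiply.\<close>

lemma pr_all_across_le:
  assumes K: "6 \<le> K" and E: "finite E" "bonds (square (K * 3 ^ J)) \<subseteq> E"
  shows "pr E (\<lambda>\<omega>. \<forall>j<J. across (K * 3 ^ j) \<omega>) \<le> (1 - 1 / 2 ^ 172) ^ J"
  using E(2)
proof (induction J)
  case 0
  then show ?case using E by (simp add: pr_True)
next
  case (Suc J)
  let ?k = "K * 3 ^ J"
  have k: "6 \<le> ?k" using K mult_mono[of 6 K 1 "3 ^ J"] by simp
  have square_le: "square a \<subseteq> square b" if "a \<le> b" for a b using that by (auto simp: rect_def)
  have bE: "bonds (square (3 * ?k)) \<subseteq> E" using Suc.prems by (simp add: ac_simps)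
  then have bE': "bonds (square ?k) \<subseteq> E" "bonds (square (3 * ?k) - square ?k) \<subseteq> E"
    using bonds_mono[of "square ?k" "square (3 * ?k)"] bonds_mono[of "square (3 * ?k) - square ?k" "square (3 * ?k)"]
      square_le[of ?k "3 * ?k"] k by auto
  have det: "determined (bonds (square ?k)) (\<lambda>\<omega>. \<forall>j<J. across (K * 3 ^ j) \<omega>)"
  proof -
    have "determined (bonds (square ?k)) (across (K * 3 ^ j))" if "j < J" for j
    proof -
      have "3 * (K * 3 ^ j) \<le> K * 3 ^ J"
        using that K power_increasing[of "Suc j" J "3 :: int"] by simp
      then have "square (3 * (K * 3 ^ j)) - square (K * 3 ^ j) \<subseteq> square ?k"
        using square_le by blast
      then show ?thesis using determined_mono[OF determined_across bonds_mono] by blast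
    qed
    then show ?thesis unfolding determined_def by blast
  qed
  have "pr E (\<lambda>\<omega>. \<forall>j<Suc J. across (K * 3 ^ j) \<omega>) =
      pr E (\<lambda>\<omega>. (\<forall>j<J. across (K * 3 ^ j) \<omega>) \<and> across ?k \<omega>)"
    by (intro pr_cong) (auto simp: less_Suc_eq)
  also have "\<dots> = pr E (\<lambda>\<omega>. \<forall>j<J. across (K * 3 ^ j) \<omega>) * pr E (across ?k)"
    by (intro pr_indep[OF E(1) bE' bonds_disjoint det determined_across]) auto
  also have "\<dots> \<le> (1 - 1 / 2 ^ 172) ^ J * (1 - 1 / 2 ^ 172)"
    by (intro mult_mono Suc.IH bE' pr_across_le k E bE) (auto simp: pr_nonneg)
  finally show ?case by (simp only: power_Suc2)
qed

theorem pr_long_path_le: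
  assumes K: "6 \<le> K" and E: "finite E" "bonds (square (K * 3 ^ J)) \<subseteq> E"
  shows "pr E (\<lambda>\<omega>. \<exists>u\<in>square K. \<exists>v. v \<notin> square (K * 3 ^ J) \<and> conn \<omega> UNIV u v) \<le> (1 - 1 / 2 ^ 172) ^ J"
proof -
  have square_le: "square a \<subseteq> square b" if "a \<le> b" for a b using that by (auto simp: rect_def)
  have "across (K * 3 ^ j) \<omega>" if "j < J" "u \<in> square K" "v \<notin> square (K * 3 ^ J)" "conn \<omega> UNIV u v" for j u v \<omega>
  proof (rule across_if_conn[OF _ that(4)])
    show "1 \<le> K * 3 ^ j" using K mult_mono[of 1 K 1 "3 ^ j"] by simp
    show "u \<in> square (K * 3 ^ j)"
      using that(2) square_le[of K "K * 3 ^ j"] K by auto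
    have "3 * (K * 3 ^ j) \<le> K * 3 ^ J"
      using that(1) K power_increasing[of "Suc j" J "3 :: int"] by simp
    then show "v \<notin> square (3 * (K * 3 ^ j))" using that(3) square_le by blast
  qed
  then have "pr E (\<lambda>\<omega>. \<exists>u\<in>square K. \<exists>v. v \<notin> square (K * 3 ^ J) \<and> conn \<omega> UNIV u v)
      \<le> pr E (\<lambda>\<omega>. \<forall>j<J. across (K * 3 ^ j) \<omega>)"
    by (intro pr_mono E) blast
  then show ?thesis using pr_all_across_le[OF assms] by linarith
qed

section \<open>The rotor walk as an exploration of percolation\<close>

text \<open>The faces of the grid whose lower left corner \<open>(p, q)\<close> has \<open>p + q\<close> even form a square lattice,
  with \<open>((p + q) / 2, (p - q) / 2)\<close> as coordinates; its bonds are the vertices of the grid.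
  Each arc borders exactly one such face.\<close>

definition face :: "site \<times> site \<Rightarrow> site" where
  "face = (\<lambda>((x, y), (x', y')). ((min x x' + min y y') div 2, (min x x' - min y y' + \<bar>x - x'\<bar>) div 2))"

text \<open>Two opposite faces among the four at a vertex have the chosen colour. Their coordinates
  add up to this point, which thus names the bond between them by its doubled midpoint.\<close>

definition bond :: "site \<Rightarrow> site" where
  "bond = (\<lambda>(x, y). (x + y - 1, x - y))"

text \<open>Half of \<open>bond v\<close>, rounded down: the lower left face at vertices of even
  coordinate sum, the upper left one at the others. Rounding in \<open>face\<close> likewise selects
  the face of the right colour without a case distinction.\<close>

definition side :: "site \<Rightarrow> site" where
  "side = (\<lambda>(x, y). ((x + y - 1) div 2, (x - y) div 2))"

definition ends :: "site \<Rightarrow> site set" where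
  "ends v = {side v, bond v - side v}"

lemma adj_side: "adj (side v) (bond v - side v)"
proof -
  obtain x y where v: "v = (x, y)" by (cases v)
  have "\<exists>a. y = 2 * a - x \<or> y = 2 * a + 1 - x" by presburger
  then obtain a where "y = 2 * a - x \<or> y = 2 * a + 1 - x" by blast
  then show ?thesis by (auto simp: v adj_def side_def bond_def; presburger)
qed

lemma side_neq: "side v \<noteq> bond v - side v"
proof
  assume "side v = bond v - side v"
  then have "adj (side v) (side v)" using adj_side[of v] by metis
  then show False by (simp add: adj_def)
qed

lemma ends_adj:
  assumes "a \<in> ends v" "b \<in> ends v" "a \<noteq> b"
  shows "adj a b" "a + b = bond v"
  using assms adj_side[of v] adj_sym[of "side v" "bond v - side v"]
  unfolding ends_def by auto

lemma inj_bond: "inj bond"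
  by (rule injI) (auto simp: bond_def)

lemma bonds_subset_range_bond: "bonds R \<subseteq> range bond"
proof
  fix z assume "z \<in> bonds R"
  then obtain u v where "adj u v" "z = u + v" unfolding bonds_def by blast
  then have "odd (fst z + snd z)" by (auto simp: adj_iff)
  then obtain a where "fst z + snd z = 2 * a + 1" by (elim oddE)
  then have "z = bond (a + 1, a + 1 - snd z)" by (cases z) (auto simp: bond_def)
  then show "z \<in> range bond" by blast
qed

lemma finite_faces_square: "finite {e. adj (fst e) (snd e) \<and> face e \<in> square B}"
proof (rule finite_subset)
  show "{e. adj (fst e) (snd e) \<and> face e \<in> square B} \<subseteq> square (2 * B + 4) \<times> square (2 * B + 4)"
  proof
    fix e assume "e \<in> {e. adj (fst e) (snd e) \<and> face e \<in> square B}"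
    moreover obtain x y x' y' where e: "e = ((x, y), (x', y'))" by (metis surj_pair)
    ultimately have a: "\<bar>x - x'\<bar> + \<bar>y - y'\<bar> = 1"
      and 1: "- B \<le> (min x x' + min y y') div 2" "(min x x' + min y y') div 2 \<le> B"
      and 2: "- B \<le> (min x x' - min y y' + \<bar>x - x'\<bar>) div 2"
        "(min x x' - min y y' + \<bar>x - x'\<bar>) div 2 \<le> B"
      by (auto simp: adj_def face_def)
    from 1 2 have "- 2 * B \<le> min x x' + min y y'" "min x x' + min y y' \<le> 2 * B + 1"
      "- 2 * B \<le> min x x' - min y y' + \<bar>x - x'\<bar>" "min x x' - min y y' + \<bar>x - x'\<bar> \<le> 2 * B + 1"
      by linarith+
    with a show "e \<in> square (2 * B + 4) \<times> square (2 * B + 4)"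
      by (auto simp: e min_def abs_if split: if_splits)
  qed
qed simp

section \<open>Rotor walks on graphs whose vertices act as two-sided mirrors\<close>

lemma other_arc:
  assumes "card (out_arcs G v) = 2" "e \<in> out_arcs G v"
  shows "other_arc G v e \<in> out_arcs G v" "other_arc G v e \<noteq> e"
    "f \<in> out_arcs G v \<Longrightarrow> f \<noteq> e \<Longrightarrow> f = other_arc G v e"
    "other_arc G v (other_arc G v e) = e"
proof -
  obtain a b where "out_arcs G v = {a, b}" "a \<noteq> b" using assms(1) by (meson card_2_iff)
  then show "other_arc G v e \<in> out_arcs G v" "other_arc G v e \<noteq> e"
    "f \<in> out_arcs G v \<Longrightarrow> f \<noteq> e \<Longrightarrow> f = other_arc G v e"
    "other_arc G v (other_arc G v e) = e"
    using assms(2) other_arc_eq[of G v a b] by auto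
qed

definition flip_rotors :: "(site, site \<times> site) pre_digraph \<Rightarrow> site set \<Rightarrow>
    (site \<Rightarrow> site \<times> site) \<Rightarrow> site \<Rightarrow> site \<times> site" where
  "flip_rotors G F \<rho> v = (if v \<in> F then other_arc G v (\<rho> v) else \<rho> v)"

text \<open>\<open>face_out\<close> and \<open>face_in\<close> carry the geometry common to both
  lattices: the outgoing arcs of a vertex border its two different faces, and so do the incoming
  ones.\<close>

locale rotor_lattice =
  fixes G :: "(site, site \<times> site) pre_digraph" and v0 :: site
  assumes verts_G: "verts G = UNIV" and tail_G: "tail G = fst" and head_G: "head G = snd"
    and arcs_adj: "e \<in> arcs G \<Longrightarrow> adj (fst e) (snd e)"
    and face_out: "bij_betw face (out_arcs G v) (ends v)"
    and face_in: "bij_betw face (in_arcs G v) (ends v)"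
begin

definition pos :: "(site \<Rightarrow> site \<times> site) \<Rightarrow> nat \<Rightarrow> site" where
  "pos \<rho> t = rotor_walk G v0 \<rho> t"

definition visits :: "(site \<Rightarrow> site \<times> site) \<Rightarrow> nat \<Rightarrow> site \<Rightarrow> nat" where
  "visits \<rho> t v = card {s. s < t \<and> pos \<rho> s = v}"

text \<open>Before step \<open>t\<close> the rotor has been switched once per earlier visit, and the
  step switches it once more. Two switches cancel, so only the parity counts.\<close>

definition used_arc :: "(site \<Rightarrow> site \<times> site) \<Rightarrow> nat \<Rightarrow> site \<times> site" where
  "used_arc \<rho> t = (if even (visits \<rho> t (pos \<rho> t)) then other_arc G (pos \<rho> t) (\<rho> (pos \<rho> t)) else \<rho> (pos \<rho> t))"

definition valid :: "(site \<Rightarrow> site \<times> site) \<Rightarrow> bool" where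
  "valid \<rho> \<longleftrightarrow> (\<forall>v. \<rho> v \<in> out_arcs G v)"

definition noreturn :: "nat \<Rightarrow> (site \<Rightarrow> site \<times> site) \<Rightarrow> bool" where
  "noreturn T \<rho> \<longleftrightarrow> (\<forall>t. 0 < t \<and> t \<le> T \<longrightarrow> pos \<rho> t \<noteq> v0)"

lemma card_out [simp]: "card (out_arcs G v) = 2"
  using bij_betw_same_card[OF face_out[of v]] side_neq[of v] by (simp add: ends_def)

lemma card_in [simp]: "card (in_arcs G v) = 2"
  using bij_betw_same_card[OF face_in[of v]] side_neq[of v] by (simp add: ends_def)

lemmas other = other_arc[OF card_out]

lemma face_out_in_ends: "e \<in> out_arcs G v \<Longrightarrow> face e \<in> ends v"
  using face_out[of v] unfolding bij_betw_def by blast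

lemma face_in_in_ends: "e \<in> in_arcs G v \<Longrightarrow> face e \<in> ends v"
  using face_in[of v] unfolding bij_betw_def by blast

lemma face_out_inj: "e \<in> out_arcs G v \<Longrightarrow> f \<in> out_arcs G v \<Longrightarrow> face e = face f \<Longrightarrow> e = f"
  using face_out[of v] unfolding bij_betw_def inj_on_def by blast

lemma face_in_inj: "e \<in> in_arcs G v \<Longrightarrow> f \<in> in_arcs G v \<Longrightarrow> face e = face f \<Longrightarrow> e = f"
  using face_in[of v] unfolding bij_betw_def inj_on_def by blast

lemma validD: "valid \<rho> \<Longrightarrow> \<rho> v \<in> out_arcs G v"
  by (simp add: valid_def)

lemma other_valid: "valid \<rho> \<Longrightarrow> other_arc G v (\<rho> v) \<in> out_arcs G v"
  by (rule other(1)[OF validD])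

lemma valid_flip_rotors: "valid \<rho> \<Longrightarrow> valid (flip_rotors G F \<rho>)"
  unfolding valid_def[of "flip_rotors G F \<rho>"] flip_rotors_def using other_valid validD by auto

lemma visits_Suc: "visits \<rho> (Suc t) v = (if pos \<rho> t = v then Suc (visits \<rho> t v) else visits \<rho> t v)"
proof -
  have "{s. s < Suc t \<and> pos \<rho> s = v} = (if pos \<rho> t = v then insert t else id) {s. s < t \<and> pos \<rho> s = v}"
    by (auto simp: less_Suc_eq)
  then show ?thesis by (simp add: visits_def)
qed

lemma visits_0 [simp]: "visits \<rho> 0 v = 0"
  by (simp add: visits_def)

lemma rotor_state:
  assumes "valid \<rho>"
  shows "(rotor_step G ^^ t) (v0, \<rho>) = (pos \<rho> t, flip_rotors G {v. odd (visits \<rho> t v)} \<rho>)"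
proof (induction t)
  case 0
  then show ?case by (simp add: pos_def rotor_walk_def flip_rotors_def fun_eq_iff)
next
  case (Suc t)
  let ?f = "\<lambda>t. flip_rotors G {v. odd (visits \<rho> t v)} \<rho>"
  have "snd ((rotor_step G ^^ Suc t) (v0, \<rho>)) = (?f t)(pos \<rho> t := other_arc G (pos \<rho> t) (?f t (pos \<rho> t)))"
    using Suc by (simp add: rotor_step_def Let_def)
  also have "\<dots> = ?f (Suc t)"
    using other(4)[OF validD[OF assms]] by (auto simp: fun_eq_iff flip_rotors_def visits_Suc)
  finally show ?case by (simp add: pos_def rotor_walk_def prod_eq_iff)
qed

lemma pos_0 [simp]: "pos \<rho> 0 = v0"
  by (simp add: pos_def rotor_walk_def)

lemma arc_out: "valid \<rho> \<Longrightarrow> used_arc \<rho> t \<in> out_arcs G (pos \<rho> t)"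
  unfolding used_arc_def using other_valid validD by auto

lemma pos_Suc:
  assumes "valid \<rho>"
  shows "pos \<rho> (Suc t) = snd (used_arc \<rho> t)"
proof -
  have "pos \<rho> (Suc t) = fst (rotor_step G ((rotor_step G ^^ t) (v0, \<rho>)))"
    by (simp add: pos_def rotor_walk_def)
  also have "\<dots> = snd (other_arc G (pos \<rho> t) (flip_rotors G {v. odd (visits \<rho> t v)} \<rho> (pos \<rho> t)))"
    unfolding rotor_state[OF assms] by (simp add: rotor_step_def Let_def head_G)
  also have "\<dots> = snd (used_arc \<rho> t)"
    using other(4)[OF validD[OF assms]] by (simp add: used_arc_def flip_rotors_def)
  finally show ?thesis .
qed

lemma arc_adj: "valid \<rho> \<Longrightarrow> adj (fst (used_arc \<rho> t)) (snd (used_arc \<rho> t))"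
  using arc_out[of \<rho> t] by (intro arcs_adj) (simp add: out_arcs_def)

lemma arc_in: "valid \<rho> \<Longrightarrow> used_arc \<rho> t \<in> in_arcs G (pos \<rho> (Suc t))"
  using arc_out[of \<rho> t] by (simp add: pos_Suc in_arcs_def out_arcs_def head_G)

lemma pos_agree:
  assumes "valid \<rho>" "valid \<rho>'" "\<forall>s\<le>t. pos \<rho> s = pos \<rho>' s" "\<rho> (pos \<rho> t) = \<rho>' (pos \<rho> t)"
  shows "pos \<rho> (Suc t) = pos \<rho>' (Suc t)"
proof -
  have "{s. s < t \<and> pos \<rho> s = v} = {s. s < t \<and> pos \<rho>' s = v}" for v
    using assms(3) by auto
  then have "visits \<rho> t = visits \<rho>' t" by (simp add: visits_def fun_eq_iff)
  then have "used_arc \<rho> t = used_arc \<rho>' t" using assms by (simp add: used_arc_def)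
  then show ?thesis using assms by (simp add: pos_Suc)
qed

lemma pos_shift:
  assumes "valid \<rho>" "pos \<rho> t0 = v0"
  shows "pos (flip_rotors G {v. odd (visits \<rho> t0 v)} \<rho>) t = pos \<rho> (t + t0)"
proof -
  have "pos \<rho> (t + t0) = fst ((rotor_step G ^^ t) ((rotor_step G ^^ t0) (v0, \<rho>)))"
    by (simp add: pos_def rotor_walk_def funpow_add)
  then show ?thesis
    by (simp add: rotor_state[OF assms(1)] assms(2)) (simp add: pos_def rotor_walk_def)
qed

subsection \<open>A walk that does not return repeats no arc\<close>

lemma visits_between:
  assumes "s < t" "pos \<rho> s = v" "\<forall>r. s < r \<and> r < t \<longrightarrow> pos \<rho> r \<noteq> v"
  shows "visits \<rho> t v = Suc (visits \<rho> s v)"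
proof -
  have "{r. r < t \<and> pos \<rho> r = v} = insert s {r. r < s \<and> pos \<rho> r = v}"
    using assms by auto (metis linorder_neqE_nat)
  then show ?thesis by (simp add: visits_def)
qed

lemma arc_alternate:
  assumes "valid \<rho>" "s < t" "pos \<rho> s = pos \<rho> t" "\<forall>r. s < r \<and> r < t \<longrightarrow> pos \<rho> r \<noteq> pos \<rho> t"
  shows "used_arc \<rho> s \<noteq> used_arc \<rho> t"
proof -
  have "visits \<rho> t (pos \<rho> t) = Suc (visits \<rho> s (pos \<rho> t))"
    using assms by (intro visits_between) auto
  then show ?thesis
    using other(2)[OF validD[OF assms(1)], of "pos \<rho> t"] assms(3)
    by (simp add: used_arc_def)
qed

lemma two_in_arcs:
  assumes "e \<in> in_arcs G v" "f \<in> in_arcs G v" "g \<in> in_arcs G v" "e \<noteq> f" "f \<noteq> g" "e \<noteq> g"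
  shows False
proof -
  have "card {e, f, g} \<le> card (in_arcs G v)"
    using assms by (intro card_mono card_ge_0_finite) auto
  then show False using assms by simp
qed

text \<open>Strong induction on the later time. Since consecutive visits alternate the arcs, an arc
  repeated at \<open>s\<close> and \<open>t\<close> forces a third visit in between. The vertex is
  not \<open>v0\<close>, so all three visits are preceded by incoming arcs; these are used before
  time \<open>t\<close>, hence distinct by induction, in contradiction to indegree 2.\<close>

lemma arcs_distinct:
  assumes "valid \<rho>" "noreturn T \<rho>" "s < t" "t \<le> T"
  shows "used_arc \<rho> s \<noteq> used_arc \<rho> t"
  using assms(3,4)
proof (induction t arbitrary: s rule: less_induct)
  case (less t)
  show ?case
  proof
    assume eq: "used_arc \<rho> s = used_arc \<rho> t"
    then have pos: "pos \<rho> s = pos \<rho> t"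
      using arc_out[OF assms(1), of s] arc_out[OF assms(1), of t] by (simp add: out_arcs_def tail_G)
    then obtain r where r: "s < r" "r < t" "pos \<rho> r = pos \<rho> t"
      using arc_alternate[OF assms(1) less.prems(1)] eq by blast
    have "pos \<rho> t \<noteq> v0" using assms(2) less.prems by (simp add: noreturn_def)
    then have "s \<noteq> 0" using pos by (metis pos_0)
    then obtain s' r' t' where s: "s = Suc s'" "r = Suc r'" "t = Suc t'"
      using r by (metis less_nat_zero_code not0_implies_Suc)
    have "used_arc \<rho> s' \<in> in_arcs G (pos \<rho> t)" "used_arc \<rho> r' \<in> in_arcs G (pos \<rho> t)" "used_arc \<rho> t' \<in> in_arcs G (pos \<rho> t)"
      using arc_in[OF assms(1)] pos r s by metis+
    moreover have "used_arc \<rho> s' \<noteq> used_arc \<rho> r'" "used_arc \<rho> r' \<noteq> used_arc \<rho> t'" "used_arc \<rho> s' \<noteq> used_arc \<rho> t'"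
      using less.IH less.prems r s by auto
    ultimately show False by (rule two_in_arcs)
  qed
qed

lemma at_most_two_visits:
  assumes "valid \<rho>" "noreturn T \<rho>" "s < r" "r < t" "t \<le> T" "pos \<rho> s = pos \<rho> t" "pos \<rho> r = pos \<rho> t"
  shows False
proof -
  have "pos \<rho> t \<noteq> v0" using assms by (simp add: noreturn_def)
  then have "s \<noteq> 0" using assms by (metis pos_0)
  then obtain s' r' t' where s: "s = Suc s'" "r = Suc r'" "t = Suc t'"
    using assms by (metis less_nat_zero_code not0_implies_Suc)
  have "used_arc \<rho> s' \<in> in_arcs G (pos \<rho> t)" "used_arc \<rho> r' \<in> in_arcs G (pos \<rho> t)" "used_arc \<rho> t' \<in> in_arcs G (pos \<rho> t)"
    using arc_in[OF assms(1)] assms s by metis+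
  moreover have "used_arc \<rho> s' \<noteq> used_arc \<rho> r'" "used_arc \<rho> r' \<noteq> used_arc \<rho> t'" "used_arc \<rho> s' \<noteq> used_arc \<rho> t'"
    using arcs_distinct[OF assms(1,2)] assms s by auto
  ultimately show False by (rule two_in_arcs)
qed

subsection \<open>The percolation configuration explored by the walk\<close>

text \<open>The walk enters \<open>pos \<rho> t\<close> along an arc bordering the face \<open>entry \<rho> t\<close>; at time \<open>0\<close> this is an
  arbitrary choice. The bond of a vertex is open if the first arc leaving the vertex borders
  another face than the first arc entering it. A second passage uses the two other arcs, so it
  changes the face if and only if the first passage did.\<close>

definition entry :: "(site \<Rightarrow> site \<times> site) \<Rightarrow> nat \<Rightarrow> site" where
  "entry \<rho> t = (if t = 0 then side v0 else face (used_arc \<rho> (t - 1)))"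

text \<open>A vertex not visited up to time \<open>T\<close> gets the default reference face
  \<open>side v\<close>, so that its rotor still decides a bond and every vertex contributes one
  fair bit.\<close>

definition first_face :: "nat \<Rightarrow> (site \<Rightarrow> site \<times> site) \<Rightarrow> site \<Rightarrow> site" where
  "first_face T \<rho> v = (if \<exists>t\<le>T. pos \<rho> t = v then entry \<rho> (LEAST t. pos \<rho> t = v) else side v)"

definition opens :: "nat \<Rightarrow> (site \<Rightarrow> site \<times> site) \<Rightarrow> site \<Rightarrow> bool" where
  "opens T \<rho> v \<longleftrightarrow> face (other_arc G v (\<rho> v)) \<noteq> first_face T \<rho> v"

definition explored :: "nat \<Rightarrow> site set \<Rightarrow> (site \<Rightarrow> site \<times> site) \<Rightarrow> site set" where
  "explored T \<Lambda> \<rho> = bond ` {v \<in> \<Lambda>. opens T \<rho> v}"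

lemma entry_in_ends: "valid \<rho> \<Longrightarrow> entry \<rho> t \<in> ends (pos \<rho> t)"
  using face_in_in_ends[OF arc_in[of \<rho> "t - 1"]] by (cases t) (auto simp: entry_def ends_def)

lemma first_face_in_ends:
  assumes "valid \<rho>" shows "first_face T \<rho> v \<in> ends v"
proof (cases "\<exists>t\<le>T. pos \<rho> t = v")
  case True
  then obtain t where "pos \<rho> t = v" by blast
  then have "pos \<rho> (LEAST t. pos \<rho> t = v) = v" by (rule LeastI)
  moreover have "first_face T \<rho> v = entry \<rho> (LEAST t. pos \<rho> t = v)"
    unfolding first_face_def using True by (rule if_P)
  ultimately show ?thesis using entry_in_ends[OF assms, of "LEAST t. pos \<rho> t = v"] by simp
next
  case False
  then show ?thesis by (simp only: first_face_def ends_def if_False insertI1)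
qed

text \<open>The two outgoing arcs border different faces, so the first face together with the state
  of the bond determines the first arc out, and hence the rotor.\<close>

lemma opens_determines_rotor:
  assumes "valid \<rho>" "valid \<rho>'" "first_face T \<rho> v = first_face T \<rho>' v" "opens T \<rho> v = opens T \<rho>' v"
  shows "\<rho> v = \<rho>' v"
proof -
  have "face (other_arc G v (\<rho> v)) \<in> ends v" "face (other_arc G v (\<rho>' v)) \<in> ends v"
    using face_out_in_ends other_valid assms by blast+
  then have "face (other_arc G v (\<rho> v)) = face (other_arc G v (\<rho>' v))"
    using assms(3,4) first_face_in_ends[OF assms(1), of T v] by (auto simp: opens_def ends_def)
  then have "other_arc G v (\<rho> v) = other_arc G v (\<rho>' v)"
    using face_out_inj other_valid assms by blast
  from arg_cong[OF this, of "other_arc G v"] show ?thesis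
    by (simp only: other(4)[OF validD[OF assms(1)]] other(4)[OF validD[OF assms(2)]])
qed

text \<open>The walk is reconstructed step by step up to time \<open>T\<close>. Once positions and
  arcs agree, so do all first faces, including the defaults at unvisited vertices, and then all
  rotors.\<close>

lemma explored_inj:
  assumes "valid \<rho>" "valid \<rho>'" "explored T \<Lambda> \<rho> = explored T \<Lambda> \<rho>'" "\<forall>v. v \<notin> \<Lambda> \<longrightarrow> \<rho> v = \<rho>' v"
  shows "\<rho> = \<rho>'"
proof -
  have eq: "\<rho> v = \<rho>' v" if "first_face T \<rho> v = first_face T \<rho>' v" for v
  proof (cases "v \<in> \<Lambda>")
    case True
    have "{v \<in> \<Lambda>. opens T \<rho> v} = {v \<in> \<Lambda>. opens T \<rho>' v}"
      using assms(3) unfolding explored_def inj_image_eq_iff[OF inj_bond] .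
    with True have "opens T \<rho> v = opens T \<rho>' v" by blast
    then show ?thesis using opens_determines_rotor[OF assms(1,2) that] by blast
  next
    case False
    then show ?thesis using assms(4) by blast
  qed
  have arc_face: "used_arc \<rho> s = used_arc \<rho>' s" if "\<forall>r\<le>s. pos \<rho> r = pos \<rho>' r" "\<rho> (pos \<rho> s) = \<rho>' (pos \<rho> s)" for s
  proof -
    have "{r. r < s \<and> pos \<rho> r = v} = {r. r < s \<and> pos \<rho>' r = v}" for v
      using that(1) by auto
    then have "visits \<rho> s = visits \<rho>' s" by (simp add: visits_def fun_eq_iff)
    then show ?thesis using that by (simp add: used_arc_def)
  qed
  have agree: "t \<le> T \<longrightarrow> (\<forall>s\<le>t. pos \<rho> s = pos \<rho>' s) \<and> (\<forall>s<t. used_arc \<rho> s = used_arc \<rho>' s)" for t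
  proof (induction t)
    case (Suc t)
    show ?case
    proof
      assume "Suc t \<le> T"
      then have IH: "\<forall>s\<le>t. pos \<rho> s = pos \<rho>' s" "\<forall>s<t. used_arc \<rho> s = used_arc \<rho>' s" using Suc by auto
      let ?v = "pos \<rho> t"
      \<comment> \<open>The first visit to the current vertex is not later than \<open>t\<close>, so
        \<open>first_face\<close> there refers only to arcs already known to agree.\<close>
      have L: "(LEAST s. pos \<rho> s = ?v) \<le> t" by (rule Least_le) simp
      have "(LEAST s. pos \<rho> s = ?v) = (LEAST s. pos \<rho>' s = ?v)"
      proof (rule Least_equality[symmetric])
        show "pos \<rho>' (LEAST s. pos \<rho> s = ?v) = ?v"
          using IH(1) L LeastI[of "\<lambda>s. pos \<rho> s = ?v" t] by auto
        show "(LEAST s. pos \<rho> s = ?v) \<le> y" if "pos \<rho>' y = ?v" for y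
        proof (cases "y \<le> t")
          case True
          then show ?thesis using that IH(1) by (intro Least_le) simp
        qed (use L in simp)
      qed
      moreover have "entry \<rho> s = entry \<rho>' s" if "s \<le> t" for s
        using that IH(2) by (cases s) (auto simp: entry_def)
      moreover have "\<exists>s\<le>T. pos \<rho> s = ?v" "\<exists>s\<le>T. pos \<rho>' s = ?v"
        using IH(1) \<open>Suc t \<le> T\<close> by (auto intro!: exI[of _ t])
      ultimately have "first_face T \<rho> ?v = first_face T \<rho>' ?v"
        using L unfolding first_face_def by metis
      then have r: "\<rho> ?v = \<rho>' ?v" by (rule eq)
      then have "used_arc \<rho> t = used_arc \<rho>' t" using arc_face IH by blast
      then show "(\<forall>s\<le>Suc t. pos \<rho> s = pos \<rho>' s) \<and> (\<forall>s<Suc t. used_arc \<rho> s = used_arc \<rho>' s)"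
        using IH pos_agree[OF assms(1,2) IH(1) r] by (auto simp: le_Suc_eq less_Suc_eq)
    qed
  qed simp
  have "first_face T \<rho> v = first_face T \<rho>' v" for v
  proof (cases "\<exists>t\<le>T. pos \<rho> t = v")
    case True
    then obtain t where t: "t \<le> T" "pos \<rho> t = v" by blast
    have XT: "\<forall>s\<le>T. pos \<rho> s = pos \<rho>' s" using agree[of T] by blast
    have L: "(LEAST s. pos \<rho> s = v) \<le> T" using t Least_le[of "\<lambda>s. pos \<rho> s = v" t] by linarith
    have "(LEAST s. pos \<rho> s = v) = (LEAST s. pos \<rho>' s = v)"
    proof (rule Least_equality[symmetric])
      show "pos \<rho>' (LEAST s. pos \<rho> s = v) = v"
        using XT L LeastI[of "\<lambda>s. pos \<rho> s = v" t] t by auto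
      show "(LEAST s. pos \<rho> s = v) \<le> y" if "pos \<rho>' y = v" for y
      proof (cases "y \<le> T")
        case True
        then show ?thesis using that XT by (intro Least_le) simp
      qed (use L in simp)
    qed
    moreover have "entry \<rho> s = entry \<rho>' s" if "s \<le> T" for s
      using that agree[of T] by (cases s) (auto simp: entry_def)
    moreover have "\<exists>s\<le>T. pos \<rho>' s = v" using t XT by auto
    ultimately show ?thesis using L True unfolding first_face_def by metis
  next
    case False
    moreover from this have "\<not> (\<exists>t\<le>T. pos \<rho>' t = v)" using agree[of T] by auto
    ultimately show ?thesis by (simp only: first_face_def if_False)
  qed
  then show ?thesis using eq by blast
qed

lemma explored_conn:
  assumes "valid \<rho>" "noreturn T \<rho>" "pos \<rho> ` {..T} \<subseteq> \<Lambda>" "t \<le> T"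
  shows "conn (explored T \<Lambda> \<rho>) UNIV (side v0) (face (used_arc \<rho> t))"
proof -
  let ?\<omega> = "explored T \<Lambda> \<rho>"
  have step: "conn ?\<omega> UNIV (entry \<rho> t) (face (used_arc \<rho> t))" if "t \<le> T" for t
  proof (cases "face (used_arc \<rho> t) = entry \<rho> t")
    case False
    let ?v = "pos \<rho> t"
    have ends: "entry \<rho> t \<in> ends ?v" "face (used_arc \<rho> t) \<in> ends ?v"
      using entry_in_ends[OF assms(1)] face_out_in_ends[OF arc_out[OF assms(1)]] by blast+
    have "opens T \<rho> ?v"
    proof (cases "\<exists>s<t. pos \<rho> s = ?v")
      case False
      then have "(LEAST s. pos \<rho> s = ?v) = t"
        by (intro Least_equality) (auto simp: not_less[symmetric])
      then have "first_face T \<rho> ?v = entry \<rho> t"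
        using that unfolding first_face_def by auto
      moreover have "{s. s < t \<and> pos \<rho> s = ?v} = {}" using False by blast
      then have "visits \<rho> t ?v = 0" by (simp only: visits_def card.empty)
      ultimately show ?thesis
        using \<open>face (used_arc \<rho> t) \<noteq> entry \<rho> t\<close> by (simp add: opens_def used_arc_def)
    next
      \<comment> \<open>Second passage, the first being at \<open>s\<close>: the walk arrives along
        the other incoming arc and leaves along the other outgoing one. Changing the face now means
        leaving on the face of the first entry, so the first passage left on the other face.\<close>
      case True
      then obtain s where s: "s < t" "pos \<rho> s = ?v" by blast
      have only: "r = s" if "r < t" "pos \<rho> r = ?v" for r
      proof (rule ccontr)
        assume "r \<noteq> s"
        then consider "r < s" | "s < r" by linarith
        then show False
          using at_most_two_visits[OF assms(1,2) _ _ \<open>t \<le> T\<close>] s that by cases blast+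
      qed
      have L: "(LEAST r. pos \<rho> r = ?v) = s"
      proof (rule Least_equality)
        show "s \<le> y" if "pos \<rho> y = ?v" for y
          using only[of y] that s(1) by (cases "y < t") auto
      qed fact
      have "{r. r < s \<and> pos \<rho> r = ?v} = {}"
        by (auto dest: only[OF less_trans[OF _ s(1)]])
      then have "visits \<rho> s ?v = 0" by (simp only: visits_def card.empty)
      moreover have "{r. r < t \<and> pos \<rho> r = ?v} = {s}"
        using only s by blast
      then have "visits \<rho> t ?v = 1" unfolding visits_def by simp
      ultimately have e: "used_arc \<rho> t = \<rho> ?v" "used_arc \<rho> s = other_arc G ?v (\<rho> ?v)"
        using s(2) by (simp_all add: used_arc_def)
      have "?v \<noteq> v0" using assms(2) that s by (auto simp: noreturn_def)
      then have "s \<noteq> 0" using s by (metis pos_0)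
      then obtain s' t' where st: "s = Suc s'" "t = Suc t'"
        using s(1) by (metis less_nat_zero_code not0_implies_Suc)
      have "used_arc \<rho> s' \<noteq> used_arc \<rho> t'"
        using arcs_distinct[OF assms(1,2)] st s that by simp
      moreover have "used_arc \<rho> s' \<in> in_arcs G ?v" "used_arc \<rho> t' \<in> in_arcs G ?v"
        using arc_in[OF assms(1)] st s by metis+
      ultimately have "face (used_arc \<rho> s') \<noteq> face (used_arc \<rho> t')"
        using face_in_inj by blast
      then have "entry \<rho> s \<noteq> entry \<rho> t" by (simp add: entry_def st)
      moreover have "entry \<rho> s \<in> ends ?v" using entry_in_ends[OF assms(1), of s] s by simp
      ultimately have "face (used_arc \<rho> t) = entry \<rho> s"
        using ends False by (auto simp: ends_def)
      moreover have "first_face T \<rho> ?v = entry \<rho> s"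
        using L that unfolding first_face_def by auto
      moreover have "face (other_arc G ?v (\<rho> ?v)) \<noteq> face (\<rho> ?v)"
        using face_out_inj[OF other_valid validD, OF assms(1) assms(1)] other(2)[OF validD[OF assms(1)]]
        by blast
      ultimately show ?thesis by (simp add: opens_def e)
    qed
    then have "bond ?v \<in> ?\<omega>" using assms(3) that by (auto simp: explored_def)
    then show ?thesis
      using ends_adj[OF ends] False by (intro conn_edge) auto
  qed simp
  show ?thesis
    using assms(4)
  proof (induction t)
    case 0
    then show ?case using step[of 0] by (simp add: entry_def)
  next
    case (Suc t)
    then have "conn ?\<omega> UNIV (side v0) (entry \<rho> (Suc t))" by (simp add: entry_def)
    then show ?case using step[OF Suc.prems] by (rule conn_trans)
  qed
qed

text \<open>Pigeonhole: \<open>T\<close> is the number of candidate arcs bordering a face in the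
  square, and the \<open>T + 1\<close> arcs used up to time \<open>T\<close> are distinct. This
  choice of \<open>T\<close> is uniform in the rotors.\<close>

lemma noreturn_escapes:
  obtains T where "\<And>\<rho>. valid \<rho> \<Longrightarrow> noreturn T \<rho> \<Longrightarrow> \<exists>t\<le>T. face (used_arc \<rho> t) \<notin> square B"
proof
  let ?A = "{e. adj (fst e) (snd e) \<and> face e \<in> square B}"
  fix \<rho> assume \<rho>: "valid \<rho>" "noreturn (card ?A) \<rho>"
  show "\<exists>t\<le>card ?A. face (used_arc \<rho> t) \<notin> square B"
  proof (rule ccontr)
    assume "\<not> ?thesis"
    then have "used_arc \<rho> ` {..card ?A} \<subseteq> ?A"
      using arc_adj[OF \<rho>(1)] by blast
    moreover have "inj_on (used_arc \<rho>) {..card ?A}"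
      using arcs_distinct[OF \<rho>] by (intro linorder_inj_onI) auto
    ultimately have "card {..card ?A} \<le> card ?A"
      using finite_faces_square by (intro card_inj_on_le)
    then show False by simp
  qed
qed

lemma pos_in_rect:
  assumes "valid \<rho>"
  shows "pos \<rho> t \<in> rect (fst v0 - int t) (fst v0 + int t) (snd v0 - int t) (snd v0 + int t)"
proof (induction t)
  case 0
  show ?case by (simp add: rect_def mem_Times_iff)
next
  case (Suc t)
  have "adj (pos \<rho> t) (pos \<rho> (Suc t))"
    using arc_adj[OF assms, of t] arc_out[OF assms, of t]
    by (simp add: pos_Suc[OF assms] out_arcs_def tail_G)
  with Suc show ?case
    by (cases "pos \<rho> t"; cases "pos \<rho> (Suc t)") (auto simp: adj_def)
qed

lemma noreturn_cong:
  assumes "valid \<rho>" "valid \<rho>'" "\<forall>v\<in>rect (fst v0 - int T) (fst v0 + int T) (snd v0 - int T) (snd v0 + int T). \<rho> v = \<rho>' v"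
  shows "noreturn T \<rho> = noreturn T \<rho>'"
proof -
  have agree: "t \<le> T \<longrightarrow> (\<forall>s\<le>t. pos \<rho> s = pos \<rho>' s)" for t
  proof (induction t)
    case (Suc t)
    have "pos \<rho> t \<in> rect (fst v0 - int T) (fst v0 + int T) (snd v0 - int T) (snd v0 + int T)" if "t \<le> T"
      using pos_in_rect[OF assms(1), of t] that by (cases "pos \<rho> t") auto
    then show ?case
      using Suc pos_agree[OF assms(1,2), of t] assms(3) by (auto simp: le_Suc_eq)
  qed simp
  show ?thesis using agree[of T] by (auto simp: noreturn_def)
qed

subsection \<open>The probability of not returning\<close>

text \<open>\<open>explored\<close> injects the rotor choices on \<open>\<Lambda>\<close> without
  return into the configurations with an open path leaving the large square, out of
  \<open>2 ^ card \<Lambda>\<close> possibilities on either side. The flip on \<open>F\<close> keeps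
  this injective, being an involution at each vertex. By \<open>ball\<close>, the first
  \<open>T\<close> steps take place inside \<open>\<Lambda>\<close>, so all bonds they open are
  recorded.\<close>

lemma card_noreturn_le:
  assumes \<Lambda>: "finite \<Lambda>" "F \<subseteq> \<Lambda>"
    and ext: "\<And>f v. ext f v = (if v \<in> \<Lambda> then f v else d v)" and d: "valid d"
    and T: "\<And>\<rho>. valid \<rho> \<Longrightarrow> noreturn T \<rho> \<Longrightarrow> \<exists>t\<le>T. face (used_arc \<rho> t) \<notin> square (K * 3 ^ J)"
    and ball: "rect (fst v0 - int T) (fst v0 + int T) (snd v0 - int T) (snd v0 + int T) \<subseteq> \<Lambda>"
    and bonds: "bonds (square (K * 3 ^ J)) \<subseteq> bond ` \<Lambda>"
    and K: "6 \<le> K" "side v0 \<in> square K"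
  shows "card {f \<in> PiE \<Lambda> (out_arcs G). noreturn T (flip_rotors G F (ext f))} / 2 ^ card \<Lambda>
    \<le> (1 - 1 / 2 ^ 172) ^ J"
proof -
  let ?S = "{f \<in> PiE \<Lambda> (out_arcs G). noreturn T (flip_rotors G F (ext f))}"
  let ?E = "bond ` \<Lambda>"
  let ?L = "\<lambda>\<omega>. \<exists>u\<in>square K. \<exists>v. v \<notin> square (K * 3 ^ J) \<and> conn \<omega> UNIV u v"
  let ?h = "\<lambda>f. explored T \<Lambda> (flip_rotors G F (ext f))"
  have valid: "valid (flip_rotors G F (ext f))" if "f \<in> PiE \<Lambda> (out_arcs G)" for f
    using that d by (intro valid_flip_rotors) (auto simp: valid_def ext)
  have "inj_on ?h ?S"
  proof (rule inj_onI)
    fix f g assume fg: "f \<in> ?S" "g \<in> ?S" "?h f = ?h g"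
    have "flip_rotors G F (ext f) = flip_rotors G F (ext g)"
      using fg valid \<Lambda>(2) by (intro explored_inj[OF _ _ fg(3)]) (auto simp: flip_rotors_def ext)
    then have *: "flip_rotors G F (ext f) v = flip_rotors G F (ext g) v" for v by simp
    show "f = g"
    proof (rule PiE_ext)
      show "f \<in> PiE \<Lambda> (out_arcs G)" "g \<in> PiE \<Lambda> (out_arcs G)" using fg by auto
      fix v assume v: "v \<in> \<Lambda>"
      then have fg': "f v \<in> out_arcs G v" "g v \<in> out_arcs G v" using fg by auto
      show "f v = g v"
      proof (cases "v \<in> F")
        case True
        then have "other_arc G v (f v) = other_arc G v (g v)"
          using *[of v] v by (simp add: flip_rotors_def ext)
        from arg_cong[OF this, of "other_arc G v"] show ?thesis
          by (simp only: other(4)[OF fg'(1)] other(4)[OF fg'(2)])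
      next
        case False
        then show ?thesis using *[of v] v by (simp add: flip_rotors_def ext)
      qed
    qed
  qed
  moreover have "?h ` ?S \<subseteq> {\<omega>. \<omega> \<subseteq> ?E \<and> ?L \<omega>}"
  proof clarify
    fix f assume f: "f \<in> PiE \<Lambda> (out_arcs G)" "noreturn T (flip_rotors G F (ext f))"
    let ?\<rho> = "flip_rotors G F (ext f)"
    obtain t where t: "t \<le> T" "face (used_arc ?\<rho> t) \<notin> square (K * 3 ^ J)"
      using T[OF valid[OF f(1)] f(2)] by blast
    have "pos ?\<rho> s \<in> \<Lambda>" if "s \<le> T" for s
      using pos_in_rect[OF valid[OF f(1)], of s] that ball by (cases "pos ?\<rho> s") auto
    then have "conn (explored T \<Lambda> ?\<rho>) UNIV (side v0) (face (used_arc ?\<rho> t))"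
      using t by (intro explored_conn valid f) auto
    then show "explored T \<Lambda> ?\<rho> \<subseteq> ?E \<and> ?L (explored T \<Lambda> ?\<rho>)"
      using t K by (auto simp: explored_def)
  qed
  moreover have "finite {\<omega>. \<omega> \<subseteq> ?E \<and> ?L \<omega>}"
    using \<Lambda> by (intro finite_configurations) simp
  ultimately have "card ?S \<le> card {\<omega>. \<omega> \<subseteq> ?E \<and> ?L \<omega>}"
    by (rule card_inj_on_le)
  moreover have "card ?E = card \<Lambda>"
    using inj_bond by (intro card_image) (auto simp: inj_on_def)
  ultimately have "card ?S / 2 ^ card \<Lambda> \<le> pr ?E ?L"
    by (simp add: pr_def divide_right_mono)
  also have "\<dots> \<le> (1 - 1 / 2 ^ 172) ^ J"
    using \<Lambda>(1) bonds by (intro pr_long_path_le K) auto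
  finally show ?thesis .
qed

section \<open>From counting to the product measure\<close>

lemma finite_out: "finite (out_arcs G v)"
  using card_out[of v] by (metis card.infinite zero_neq_numeral)

lemma out_nonempty: "out_arcs G v \<noteq> {}"
  using card_out[of v] by (metis card.empty zero_neq_numeral)

lemma uniform_rotors_eq:
  "uniform_rotors G = (\<Pi>\<^sub>M v\<in>UNIV. uniform_count_measure (out_arcs G v))"
  by (simp add: uniform_rotors_def verts_G)

lemma space_uniform_rotors: "space (uniform_rotors G) = {\<rho>. valid \<rho>}"
  by (auto simp: uniform_rotors_eq space_PiM space_uniform_count_measure valid_def PiE_def)

lemma emeasure_cylinder:
  assumes "finite \<Lambda>" "f \<in> PiE \<Lambda> (out_arcs G)"
  shows "{\<rho> \<in> space (uniform_rotors G). \<forall>v\<in>\<Lambda>. \<rho> v \<in> {f v}} \<in> sets (uniform_rotors G)"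
    and "emeasure (uniform_rotors G) {\<rho> \<in> space (uniform_rotors G). \<forall>v\<in>\<Lambda>. \<rho> v \<in> {f v}}
      = ennreal (1 / 2 ^ card \<Lambda>)"
proof -
  have f: "{f v} \<in> sets (uniform_count_measure (out_arcs G v))" if "v \<in> \<Lambda>" for v
    using assms that by (auto simp: sets_uniform_count_measure)
  have "prob_space (uniform_count_measure (out_arcs G v))" for v
    using finite_out[of v] out_nonempty[of v] by (intro prob_space_uniform_count_measure)
  then interpret rotors: product_prob_space "\<lambda>v. uniform_count_measure (out_arcs G v)" UNIV
    by (rule product_prob_spaceI)
  have "emeasure (uniform_count_measure (out_arcs G v)) {f v} = ennreal (1 / 2)" if "v \<in> \<Lambda>" for v
    using assms that finite_out[of v] by (subst emeasure_uniform_count_measure) auto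
  then have "(\<Prod>v\<in>\<Lambda>. emeasure (uniform_count_measure (out_arcs G v)) {f v}) = (\<Prod>v\<in>\<Lambda>. ennreal (1 / 2))"
    by (intro prod.cong refl)
  also have "\<dots> = ennreal ((1 / 2) ^ card \<Lambda>)"
    by (simp only: prod_constant ennreal_power zero_le_divide_1_iff zero_le_numeral)
  also have "(1 / 2) ^ card \<Lambda> = (1 / 2 ^ card \<Lambda> :: real)" by (rule power_one_over)
  finally show "emeasure (uniform_rotors G) {\<rho> \<in> space (uniform_rotors G). \<forall>v\<in>\<Lambda>. \<rho> v \<in> {f v}}
      = ennreal (1 / 2 ^ card \<Lambda>)"
    using rotors.emeasure_PiM_Collect[of \<Lambda> "\<lambda>v. {f v}"] assms(1) f
    by (simp add: uniform_rotors_eq)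
  show "{\<rho> \<in> space (uniform_rotors G). \<forall>v\<in>\<Lambda>. \<rho> v \<in> {f v}} \<in> sets (uniform_rotors G)"
  proof (intro sets.sets_Collect_finite_All assms(1))
    fix v assume "v \<in> \<Lambda>"
    have "(\<lambda>\<rho>. \<rho> v) -` {f v} \<inter> space (uniform_rotors G) \<in> sets (uniform_rotors G)"
      unfolding uniform_rotors_eq
      by (intro measurable_sets[OF measurable_component_singleton] f \<open>v \<in> \<Lambda>\<close> UNIV_I)
    moreover have "(\<lambda>\<rho>. \<rho> v) -` {f v} \<inter> space (uniform_rotors G) =
        {\<rho> \<in> space (uniform_rotors G). \<rho> v \<in> {f v}}"
      by blast
    ultimately show "{\<rho> \<in> space (uniform_rotors G). \<rho> v \<in> {f v}} \<in> sets (uniform_rotors G)"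
      by simp
  qed
qed

text \<open>Covering the event by finitely many cylinders over a finite \<open>\<Lambda>\<close>
  supplies a measurable set and reduces the bound to \<open>card_noreturn_le\<close>.\<close>

lemma noreturn_event_le:
  assumes F: "finite F"
  shows "\<exists>N\<in>sets (uniform_rotors G). emeasure (uniform_rotors G) N \<le> ennreal ((1 - 1 / 2 ^ 172) ^ J) \<and>
    {\<rho>. valid \<rho> \<and> (\<forall>T. noreturn T (flip_rotors G F \<rho>))} \<subseteq> N"
proof -
  define K where "K = max 6 (max \<bar>fst (side v0)\<bar> \<bar>snd (side v0)\<bar>)"
  have K: "6 \<le> K" "side v0 \<in> square K" by (auto simp: K_def rect_def mem_Times_iff)
  obtain T where T: "\<And>\<rho>. valid \<rho> \<Longrightarrow> noreturn T \<rho> \<Longrightarrow> \<exists>t\<le>T. face (used_arc \<rho> t) \<notin> square (K * 3 ^ J)"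
    using noreturn_escapes by blast
  let ?R = "rect (fst v0 - int T) (fst v0 + int T) (snd v0 - int T) (snd v0 + int T)"
  let ?B = "bonds (square (K * 3 ^ J))"
  \<comment> \<open>The flipped vertices, those within reach in \<open>T\<close> steps, and those
    whose bonds lie in the large square.\<close>
  define \<Lambda> where "\<Lambda> = F \<union> ?R \<union> bond -` ?B"
  have \<Lambda>: "finite \<Lambda>"
    using F by (auto simp: \<Lambda>_def intro!: finite_vimageI inj_bond finite_bonds)
  have B\<Lambda>: "?B \<subseteq> bond ` \<Lambda>"
  proof
    fix z assume z: "z \<in> ?B"
    then obtain v where "z = bond v" using bonds_subset_range_bond by blast
    then show "z \<in> bond ` \<Lambda>" using z unfolding \<Lambda>_def by blast
  qed
  define d where "d v = (SOME e. e \<in> out_arcs G v)" for v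
  have d: "valid d"
    unfolding valid_def d_def using card_out by (metis card.empty some_in_eq zero_neq_numeral)
  define ext where "ext f v = (if v \<in> \<Lambda> then f v else d v)" for f v
  define S where "S = {f \<in> PiE \<Lambda> (out_arcs G). noreturn T (flip_rotors G F (ext f))}"
  have finS: "finite S"
    unfolding S_def using \<Lambda> finite_out by (intro finite_subset[OF _ finite_PiE[of \<Lambda> "out_arcs G"]]) auto
  define C where "C f = {\<rho> \<in> space (uniform_rotors G). \<forall>v\<in>\<Lambda>. \<rho> v \<in> {f v}}" for f
  have C: "C f \<in> sets (uniform_rotors G)" "emeasure (uniform_rotors G) (C f) = ennreal (1 / 2 ^ card \<Lambda>)"
    if "f \<in> S" for f
    using emeasure_cylinder[OF \<Lambda>] that by (auto simp: S_def C_def)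
  have "emeasure (uniform_rotors G) (\<Union>f\<in>S. C f) \<le> (\<Sum>f\<in>S. emeasure (uniform_rotors G) (C f))"
    using finS C by (intro emeasure_subadditive_finite) auto
  also have "\<dots> = ennreal (card S / 2 ^ card \<Lambda>)"
    using C by (simp add: ennreal_of_nat_eq_real_of_nat ennreal_mult'[symmetric])
  also have "\<dots> \<le> ennreal ((1 - 1 / 2 ^ 172) ^ J)"
  proof (rule ennreal_leI, unfold S_def, rule card_noreturn_le[OF \<Lambda> _ _ d _ _ B\<Lambda> K])
    show "F \<subseteq> \<Lambda>" "?R \<subseteq> \<Lambda>" by (auto simp: \<Lambda>_def)
    show "\<exists>t\<le>T. face (used_arc \<rho> t) \<notin> square (K * 3 ^ J)" if "valid \<rho>" "noreturn T \<rho>" for \<rho>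
      using that by (rule T)
  qed (rule ext_def)
  finally have le: "emeasure (uniform_rotors G) (\<Union>f\<in>S. C f) \<le> ennreal ((1 - 1 / 2 ^ 172) ^ J)" .
  have "\<rho> \<in> (\<Union>f\<in>S. C f)" if "valid \<rho>" "\<forall>T. noreturn T (flip_rotors G F \<rho>)" for \<rho>
  proof
    let ?f = "restrict \<rho> \<Lambda>"
    have f: "?f \<in> PiE \<Lambda> (out_arcs G)" using that(1) by (auto simp: valid_def)
    have v: "valid (ext ?f)" using that(1) d by (auto simp: valid_def ext_def)
    have "noreturn T (flip_rotors G F (ext ?f)) = noreturn T (flip_rotors G F \<rho>)"
      using that(1) v by (intro noreturn_cong valid_flip_rotors)
        (auto simp: flip_rotors_def ext_def \<Lambda>_def)
    then show "?f \<in> S" using f that(2) by (simp add: S_def)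
    show "\<rho> \<in> C ?f" using that(1) by (simp add: C_def space_uniform_rotors)
  qed
  then show ?thesis
    using le finS C by (intro bexI[of _ "\<Union>f\<in>S. C f"]) auto
qed

lemma AE_returns:
  assumes F: "finite F"
  shows "AE \<rho> in uniform_rotors G. \<exists>T. \<not> noreturn T (flip_rotors G F \<rho>)"
proof -
  let ?M = "uniform_rotors G"
  let ?c = "1 - 1 / 2 ^ 172 :: real"
  have "\<forall>J. \<exists>N. N \<in> sets ?M \<and> emeasure ?M N \<le> ennreal (?c ^ J) \<and>
      {\<rho>. valid \<rho> \<and> (\<forall>T. noreturn T (flip_rotors G F \<rho>))} \<subseteq> N"
    using noreturn_event_le[OF F] by blast
  from choice[OF this] obtain N where N: "\<And>J. N J \<in> sets ?M"
    "\<And>J. emeasure ?M (N J) \<le> ennreal (?c ^ J)"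
    "\<And>J. {\<rho>. valid \<rho> \<and> (\<forall>T. noreturn T (flip_rotors G F \<rho>))} \<subseteq> N J"
    by blast
  have "emeasure ?M (\<Inter>J. N J) = 0"
  proof -
    have "(\<lambda>J. ennreal (?c ^ J)) \<longlonglongrightarrow> ennreal 0"
      by (intro tendsto_ennrealI LIMSEQ_realpow_zero) auto
    moreover have "emeasure ?M (\<Inter>J. N J) \<le> ennreal (?c ^ J)" for J
      using N(1) by (intro order.trans[OF emeasure_mono N(2)]) auto
    ultimately have "emeasure ?M (\<Inter>J. N J) \<le> ennreal 0"
      by (intro LIMSEQ_le_const) auto
    then show ?thesis by simp
  qed
  then have "(\<Inter>J. N J) \<in> null_sets ?M" using N(1) by auto
  moreover have "{\<rho> \<in> space ?M. \<not> (\<exists>T. \<not> noreturn T (flip_rotors G F \<rho>))} \<subseteq> (\<Inter>J. N J)"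
    using N(3) by (auto simp: space_uniform_rotors)
  ultimately show ?thesis by (rule AE_I')
qed

theorem AE_recurrent: "AE \<rho> in uniform_rotors G. rotor_recurrent G v0 \<rho>"
proof -
  \<comment> \<open>The set flipped at the last return is itself random, so the statement is needed
    for all finite sets at once; there are only countably many.\<close>
  have "AE \<rho> in uniform_rotors G. \<forall>F\<in>{F. finite F}. \<exists>T. \<not> noreturn T (flip_rotors G F \<rho>)"
    using AE_returns by (subst AE_ball_countable) (auto intro: countable_Collect_finite)
  moreover have "AE \<rho> in uniform_rotors G. valid \<rho>"
    by (rule AE_I2) (simp add: space_uniform_rotors)
  ultimately show ?thesis
  proof eventually_elim
    case (elim \<rho>)
    show ?case
    proof (rule ccontr)
      assume "\<not> rotor_recurrent G v0 \<rho>"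
      then have fin: "finite {t. pos \<rho> t = v0}"
        by (simp add: rotor_recurrent_def pos_def rotor_walk_def)
      define t0 where "t0 = Max {t. pos \<rho> t = v0}"
      have t0: "pos \<rho> t0 = v0" "\<And>t. pos \<rho> t = v0 \<Longrightarrow> t \<le> t0"
        using Max_in[OF fin] Max_ge[OF fin] pos_0[of \<rho>] unfolding t0_def by blast+
      let ?F = "{v. odd (visits \<rho> t0 v)}"
      have "?F \<subseteq> pos \<rho> ` {..<t0}"
      proof
        fix v assume "v \<in> ?F"
        then have "visits \<rho> t0 v \<noteq> 0" by (metis even_zero mem_Collect_eq)
        then have "{s. s < t0 \<and> pos \<rho> s = v} \<noteq> {}" unfolding visits_def by (metis card.empty)
        then show "v \<in> pos \<rho> ` {..<t0}" by auto
      qed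
      then have "finite ?F" by (rule finite_subset) simp
      then obtain T where "\<not> noreturn T (flip_rotors G ?F \<rho>)" using elim(1) by blast
      then obtain t where "0 < t" "pos \<rho> (t + t0) = v0"
        using pos_shift[OF elim(2) t0(1)] by (auto simp: noreturn_def)
      then show False using t0(2)[of "t + t0"] by simp
    qed
  qed
qed

end

section \<open>The two lattices\<close>

lemma bij_betw_face:
  assumes "e \<noteq> f"
    and "face e = side v \<and> face f = bond v - side v \<or> face f = side v \<and> face e = bond v - side v"
  shows "bij_betw face {e, f} (ends v)"
  using assms side_neq[of v] by (auto simp: bij_betw_def ends_def)

lemma rotor_lattice_F: "rotor_lattice F_lattice"
proof
  fix v :: site
  obtain x y where v: "v = (x, y)" by (cases v)
  \<comment> \<open>Splitting by the parities of \<open>x\<close> and \<open>y\<close> makes every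
    division by 2 linear.\<close>
  have "\<exists>a. x = 2 * a \<or> x = 2 * a + 1" "\<exists>b. y = 2 * b \<or> y = 2 * b + 1" by presburger+
  then obtain a b where xy: "x = 2 * a \<or> x = 2 * a + 1" "y = 2 * b \<or> y = 2 * b + 1" by blast
  show "bij_betw face (out_arcs F_lattice v) (ends v)"
    using xy unfolding v out_arcs_F_lattice
    by (elim disjE; simp; intro bij_betw_face; simp add: face_def side_def bond_def min_def; presburger)
  show "bij_betw face (in_arcs F_lattice v) (ends v)"
    using xy unfolding v in_arcs_F_lattice
    by (elim disjE; simp; intro bij_betw_face; simp add: face_def side_def bond_def min_def; presburger)
qed (auto simp: F_lattice_def adj_def)

lemma rotor_lattice_Manhattan: "rotor_lattice Manhattan_lattice"
proof
  fix v :: site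
  obtain x y where v: "v = (x, y)" by (cases v)
  have "\<exists>a. x = 2 * a \<or> x = 2 * a + 1" "\<exists>b. y = 2 * b \<or> y = 2 * b + 1" by presburger+
  then obtain a b where xy: "x = 2 * a \<or> x = 2 * a + 1" "y = 2 * b \<or> y = 2 * b + 1" by blast
  show "bij_betw face (out_arcs Manhattan_lattice v) (ends v)"
    using xy unfolding v out_arcs_Manhattan_lattice
    by (elim disjE; simp; intro bij_betw_face; simp add: face_def side_def bond_def min_def; presburger)
  show "bij_betw face (in_arcs Manhattan_lattice v) (ends v)"
    using xy unfolding v in_arcs_Manhattan_lattice
    by (elim disjE; simp; intro bij_betw_face; simp add: face_def side_def bond_def min_def; presburger)
qed (auto simp: Manhattan_lattice_def adj_def)

theorem theorem1p5:
  shows "(\<forall>v \<in> verts F_lattice.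
            AE \<rho> in uniform_rotors F_lattice. rotor_recurrent F_lattice v \<rho>) \<and>
         (\<forall>v \<in> verts Manhattan_lattice.
            AE \<rho> in uniform_rotors Manhattan_lattice. rotor_recurrent Manhattan_lattice v \<rho>)"
  using rotor_lattice.AE_recurrent[OF rotor_lattice_F]
    rotor_lattice.AE_recurrent[OF rotor_lattice_Manhattan] by blast

end
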